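(* Let $D$ be a chord diagram of braid index $3$, and let $V,W$ be words on $3$ strands (words in $a,b,c$) which close to represent $D$. Then either (i) $V$ and $W$ are cyclically equivalent, or (ii) there are positive integers $l,m,n$ such that $V$ and $W$ are cyclically equivalent to $a^lc^ma^n$ and $a^lc^na^m$, respectively.
   Context: An $n$-diagram (chord diagram) is an oriented circle with $2n$ distinct marked points partitioned into $n$ pairs (the chords), up to orientation-preserving homeomorphism. A word on $m$ strands is a word $W=A(i_1,j_1)\cdots A(i_n,j_n)$ in symbols $A(i,j)$, $1\le i<j\le m$, where $A(i,j)$ is viewed as a horizontal chord joining strands $i$ and $j$ of the identity $m$-braid, the letters being placed from top to bottom. Its closure is the $n$-diagram obtained by joining the bottom of strand $k$ to the top of strand $k+1$ ($k<m$) and the bottom of strand $m$ to the top of strand $1$; i.e. the cyclic sequence of chord labels around the circle is $L_1L_2\cdots L_m$, where $L_k$ is the increasing sequence of those $r$ with $k\in\{i_r,j_r\}$. A word closes to represent $D$ if its closure is $D$. The braid index of $D$ is the least $m$ such that $D$ is the closure of a word on $m$ strands. On three strands write $a=A(1,2)$, $b=A(2,3)$, $c=A(1,3)$. Cyclic permutation of words on three strands is the operation that moves the last letter to the front while changing it according to $a\to b\to c\to a$, that is, $W'a\mapsto bW'$, $W'b\mapsto cW'$, $W'c\mapsto aW'$. Two words are cyclically equivalent if they are related by a sequence of cyclic permutations and their inverses. *)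

theory Defs
  imports "HOL-Analysis.Analysis"
begin

text \<open>
  The model circle is the unit circle \<open>sphere 0 1\<close> in the complex plane, oriented
  counterclockwise, and a chord is the set of its two end points.
\<close>

definition chord_configurations :: "nat \<Rightarrow> complex set set set" where
  "chord_configurations n =
     {C. finite C \<and> card C = n \<and> (\<forall>c\<in>C. c \<subseteq> sphere 0 1 \<and> card c = 2) \<and> pairwise disjnt C}"

text \<open>
  A homeomorphism of the circle preserves the orientation iff it lifts through the universal
  covering \<open>cis\<close> to an increasing map of the line commuting with the deck transformations.
\<close>

definition orientation_preserving_homeo :: "(complex \<Rightarrow> complex) \<Rightarrow> bool" where
  "orientation_preserving_homeo h \<longleftrightarrow>
     (\<exists>k. homeomorphism (sphere 0 1) (sphere 0 1) h k) \<and>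
     (\<exists>F :: real \<Rightarrow> real. continuous_on UNIV F \<and> strict_mono F \<and>
        (\<forall>t. F (t + 2 * pi) = F t + 2 * pi) \<and> (\<forall>t. h (cis t) = cis (F t)))"

definition same_diagram :: "nat \<Rightarrow> (complex set set \<times> complex set set) set" where
  "same_diagram n =
     {(C, C'). C \<in> chord_configurations n \<and> C' \<in> chord_configurations n \<and>
        (\<exists>h. orientation_preserving_homeo h \<and> (\<lambda>c. h ` c) ` C = C')}"

definition chord_diagrams :: "nat \<Rightarrow> complex set set set set" where
  "chord_diagrams n = chord_configurations n // same_diagram n"

text \<open>The pair \<open>(i, j)\<close> encodes the symbol \<open>A(i,j)\<close>; strands are numbered from \<open>1\<close>.\<close>

type_synonym letter = "nat \<times> nat"

definition word_on :: "nat \<Rightarrow> letter list \<Rightarrow> bool" where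
  "word_on m W \<longleftrightarrow> 1 \<le> m \<and> (\<forall>(i, j)\<in>set W. 1 \<le> i \<and> i < j \<and> j \<le> m)"

text \<open>Chord labels are the (0-based) positions in the word.\<close>

definition strand_labels :: "letter list \<Rightarrow> nat \<Rightarrow> nat list" where
  "strand_labels W k = filter (\<lambda>r. k \<in> {fst (W ! r), snd (W ! r)}) [0..<length W]"

definition closure_labels :: "nat \<Rightarrow> letter list \<Rightarrow> nat list" where
  "closure_labels m W = concat (map (strand_labels W) [1..<Suc m])"

text \<open>
  The labels are placed counterclockwise at equidistant points of the circle. In a word on
  \<open>m\<close> strands each label occurs exactly twice, and its two positions are the ends of a chord.
\<close>

definition circle_point :: "nat \<Rightarrow> nat \<Rightarrow> complex" where
  "circle_point N p = cis (2 * pi * real p / real N)"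

definition closure_chords :: "nat \<Rightarrow> letter list \<Rightarrow> complex set set" where
  "closure_chords m W =
     (let L = closure_labels m W; N = length L in
      {{circle_point N p, circle_point N q} | p q. p < q \<and> q < N \<and> L ! p = L ! q})"

definition word_closure :: "nat \<Rightarrow> letter list \<Rightarrow> complex set set set" where
  "word_closure m W = same_diagram (length W) `` {closure_chords m W}"

definition closes_to :: "nat \<Rightarrow> letter list \<Rightarrow> complex set set set \<Rightarrow> bool" where
  "closes_to m W D \<longleftrightarrow> word_on m W \<and> word_closure m W = D"

definition braid_index :: "complex set set set \<Rightarrow> nat" where
  "braid_index D = (LEAST m. \<exists>W. closes_to m W D)"

abbreviation letter_a :: letter where "letter_a \<equiv> (1, 2)"
abbreviation letter_b :: letter where "letter_b \<equiv> (2, 3)"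
abbreviation letter_c :: letter where "letter_c \<equiv> (1, 3)"

inductive cyclic_permutation :: "letter list \<Rightarrow> letter list \<Rightarrow> bool" where
  "cyclic_permutation (W @ [letter_a]) (letter_b # W)"
| "cyclic_permutation (W @ [letter_b]) (letter_c # W)"
| "cyclic_permutation (W @ [letter_c]) (letter_a # W)"

definition cyclically_equivalent :: "letter list \<Rightarrow> letter list \<Rightarrow> bool" where
  "cyclically_equivalent = equivclp cyclic_permutation"

end

theory Submission
  imports Defs
begin

text \<open>
  Cut the circle at three points and let the cut points travel around it: whenever the next
  points of two of them are the ends of a chord, both cut points pass that chord. A word on three
  strands that closes to \<open>D\<close> is the record of one third of a full turn of such a motion, and
  cyclic permutation changes only the moment at which the record starts. As two of any three
  strands determine the letter, the motion is deterministic, so two words for \<open>D\<close> are cyclically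
  equivalent as soon as their motions share a state.

  Compare two motions at a moment when both pass the same chord \<open>{p, q}\<close>, and follow the maximal
  block of parallel chords after it; if this block has no end,
  \<open>D\<close> is the closure of a word on two strands. If the third cut points lie on different sides of \<open>{p, q}\<close>, a cut point waiting for the
  partner of its next point forces the rest of the diagram: it consists of three blocks of
  parallel chords, and the two words are \<open>c\<^sup>ma\<^sup>nc\<^sup>l\<close> and \<open>b\<^sup>nc\<^sup>mb\<^sup>l\<close>. If they lie on the same side, then
  either the motions share a state, or shortly afterwards they pass some other chord with their
  third cut points on different sides.
\<close>

section \<open>Cyclic permutations\<close>

declare One_nat_def [simp del]

text \<open>The inverse of the relabelling \<open>a \<rightarrow> b \<rightarrow> c \<rightarrow> a\<close>.\<close>

definition prev_letter :: "letter \<Rightarrow> letter" where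
  "prev_letter l = (if l = letter_a then letter_c else if l = letter_b then letter_a else letter_b)"

lemma prev_letter_simps [simp]:
  "prev_letter letter_a = letter_c" "prev_letter letter_b = letter_a"
  "prev_letter letter_c = letter_b"
  by (auto simp: prev_letter_def)

lemma cyclically_equivalent_refl [simp]: "cyclically_equivalent U U"
  by (simp add: cyclically_equivalent_def)

lemma cyclically_equivalent_sym: "cyclically_equivalent U V \<Longrightarrow> cyclically_equivalent V U"
  unfolding cyclically_equivalent_def by (rule equivclp_sym)

lemma cyclically_equivalent_trans [trans]:
  "cyclically_equivalent U V \<Longrightarrow> cyclically_equivalent V W \<Longrightarrow> cyclically_equivalent U W"
  unfolding cyclically_equivalent_def by (rule equivclp_trans)

lemma cyclically_equivalent_step:
  assumes "l \<in> {letter_a, letter_b, letter_c}"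
  shows "cyclically_equivalent (U @ [prev_letter l]) (l # U)"
proof -
  have "cyclic_permutation (U @ [prev_letter l]) (l # U)"
    using assms by (auto intro: cyclic_permutation.intros)
  then show ?thesis
    unfolding cyclically_equivalent_def by (rule r_into_equivclp)
qed

text \<open>Each cyclic permutation moves the last letter to the front, so \<open>P\<close> is
  consumed from its right end.\<close>

lemma cyclically_equivalent_append:
  assumes "set P \<subseteq> {letter_a, letter_b, letter_c}"
  shows "cyclically_equivalent (U @ map prev_letter P) (P @ U)"
  using assms
proof (induction P arbitrary: U rule: rev_induct)
  case Nil
  then show ?case by simp
next
  case (snoc l P)
  have "cyclically_equivalent ((U @ map prev_letter P) @ [prev_letter l])
      (l # U @ map prev_letter P)"
    using snoc.prems by (intro cyclically_equivalent_step) auto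
  also have "cyclically_equivalent \<dots> (P @ l # U)"
    using snoc.prems snoc.IH[of "l # U"] by auto
  finally show ?case by simp
qed

section \<open>Runs of three cut points\<close>

text \<open>The circle with its \<open>2 * N\<close> marked points is unrolled to the integers, and \<open>R\<close> relates the lifts
  of the two ends of a chord.\<close>

locale chord_line =
  fixes N :: nat and R :: "int \<Rightarrow> int \<Rightarrow> bool"
  assumes N_pos: "0 < N"
    and R_sym: "R p q \<Longrightarrow> R q p"
    and R_irrefl: "\<not> R p p"
    and R_period: "R (p + 2 * int N) q \<longleftrightarrow> R p q"
    and R_unique: "R p q \<Longrightarrow> R p q' \<Longrightarrow> 2 * int N dvd q - q'"
begin

lemma R_period': "R p (q + 2 * int N) \<longleftrightarrow> R p q"
  using R_period R_sym by blast

lemma R_partner_eq: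
  assumes "R p q" "R p q'" "\<bar>q - q'\<bar> < 2 * int N"
  shows "q = q'"
proof (rule ccontr)
  assume "q \<noteq> q'"
  then have "2 * int N \<le> \<bar>q - q'\<bar>"
    using R_unique[OF assms(1,2)] dvd_imp_le_int[of "q - q'" "2 * int N"] by simp
  then show False
    using assms(3) by simp
qed

lemma R_cong:
  assumes "2 * int N dvd p - p'"
  shows "R p q \<longleftrightarrow> R p' q"
proof -
  have nonneg: "R (r + 2 * int N * int k) q \<longleftrightarrow> R r q" for r and k :: nat
  proof (induction k)
    case (Suc k)
    then show ?case
      using R_period[of "r + 2 * int N * int k" q] by (simp add: algebra_simps)
  qed simp
  obtain e where e: "p - p' = 2 * int N * e"
    using assms by blast
  show ?thesis
  proof (cases "e \<ge> 0")
    case True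
    then show ?thesis
      using nonneg[of p' "nat e"] e by (simp add: algebra_simps)
  next
    case False
    then show ?thesis
      using nonneg[of p "nat (- e)"] e by (simp add: algebra_simps)
  qed
qed

lemma R_cong':
  "2 * int N dvd q - q' \<Longrightarrow> R p q \<longleftrightarrow> R p q'"
  using R_cong R_sym by blast

text \<open>All chords join antipodal points: \<open>N\<close> consecutive chords of this kind
  already use up all \<open>2 * N\<close> points. Such a diagram is the closure of a power of
  \<open>letter_a\<close> on two strands.\<close>

definition parallel :: bool where
  "parallel \<longleftrightarrow> (\<exists>p. \<forall>t<N. R (p + int t) (p + int N + int t))"

text \<open>Translation by \<open>q - p\<close>, applied twice, leads from an end to its partner and
  back to the same end. Modulo a full turn it is therefore a nonzero element of order two, that is,
  the half turn.\<close>

lemma parallelI: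
  assumes "\<And>t :: nat. R (p + int t) (q + int t)"
  shows parallel
proof -
  define r where "r = (q - p) mod (2 * int N)"
  have r: "0 \<le> r" "r < 2 * int N"
    using N_pos by (simp_all add: r_def)
  have "2 * int N dvd (q + int t) - (p + r + int t)" for t
    by (simp add: r_def algebra_simps minus_mod_eq_mult_div[symmetric])
       (metis add.commute diff_diff_eq dvd_minus_mod)
  then have R_r: "R (p + int t) (p + r + int t)" for t
    using assms R_cong' by blast
  have "R (p + r) p" "R (p + r) (p + r + r)"
    using R_r[of 0] R_sym R_r[of "nat r"] r by (simp_all add: algebra_simps)
  then have "2 * int N dvd 2 * r"
    using R_unique[of "p + r" "p + r + r" p] by simp
  moreover have "r \<noteq> 0"
    using R_r[of 0] R_irrefl by auto
  ultimately obtain c where c: "r = int N * c" "r > 0"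
    using r by auto
  then have "0 < c" "int N * c < int N * 2"
    using r N_pos by (auto simp: zero_less_mult_iff)
  then have "c = 1"
    using N_pos by (simp only: mult_less_cancel_left_pos of_nat_0_less_iff)
  then have "r = int N"
    using c by simp
  then show ?thesis
    unfolding parallel_def using R_r by metis
qed


text \<open>The cut points \<open>x\<close>, \<open>y\<close>, \<open>z\<close> are the next points to be passed on the strands 1, 2, 3; after \<open>N\<close> steps
  each strand continues at the top of the next one, which relabels the letters.\<close>

definition run where
  "run w x y z \<longleftrightarrow>
     (\<forall>i. (w i = letter_a \<and> R (x i) (y i) \<and> x (Suc i) = x i + 1 \<and> y (Suc i) = y i + 1 \<and> z (Suc i) = z i) \<or>
          (w i = letter_b \<and> R (y i) (z i) \<and> x (Suc i) = x i \<and> y (Suc i) = y i + 1 \<and> z (Suc i) = z i + 1) \<or>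
          (w i = letter_c \<and> R (x i) (z i) \<and> x (Suc i) = x i + 1 \<and> y (Suc i) = y i \<and> z (Suc i) = z i + 1)) \<and>
     (\<forall>i. x i < y i \<and> y i < z i \<and> z i < x i + 2 * int N) \<and>
     (\<forall>i. w (i + N) = prev_letter (w i) \<and> x (i + N) = y i \<and> y (i + N) = z i \<and>
          z (i + N) = x i + 2 * int N)"
  for w :: "nat \<Rightarrow> letter" and x y z :: "nat \<Rightarrow> int"

section \<open>Symmetry, determinism and waiting strands\<close>

lemma run_step:
  assumes "run w x y z"
  shows "(w i = letter_a \<and> R (x i) (y i) \<and> x (Suc i) = x i + 1 \<and> y (Suc i) = y i + 1 \<and> z (Suc i) = z i) \<or>
         (w i = letter_b \<and> R (y i) (z i) \<and> x (Suc i) = x i \<and> y (Suc i) = y i + 1 \<and> z (Suc i) = z i + 1) \<or>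
         (w i = letter_c \<and> R (x i) (z i) \<and> x (Suc i) = x i + 1 \<and> y (Suc i) = y i \<and> z (Suc i) = z i + 1)"
  using assms unfolding run_def by blast

lemma run_bounds:
  assumes "run w x y z"
  shows "x i < y i" "y i < z i" "z i < x i + 2 * int N"
  using assms unfolding run_def by blast+

lemma run_period:
  assumes "run w x y z"
  shows "w (i + N) = prev_letter (w i)" "x (i + N) = y i" "y (i + N) = z i"
    "z (i + N) = x i + 2 * int N"
  using assms unfolding run_def by blast+

text \<open>Renaming the strands cyclically is a symmetry of runs; used once or twice, it carries
  facts about \<open>letter_a\<close> over to \<open>letter_b\<close> and
  \<open>letter_c\<close>.\<close>

lemma run_rotate:
  assumes "run w x y z"
  shows "run (\<lambda>i. prev_letter (w i)) y z (\<lambda>i. x i + 2 * int N)"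
  unfolding run_def
proof (intro conjI allI)
  fix i
  show "(prev_letter (w i) = letter_a \<and> R (y i) (z i) \<and> y (Suc i) = y i + 1 \<and> z (Suc i) = z i + 1 \<and>
          x (Suc i) + 2 * int N = x i + 2 * int N) \<or>
        (prev_letter (w i) = letter_b \<and> R (z i) (x i + 2 * int N) \<and> y (Suc i) = y i \<and> z (Suc i) = z i + 1 \<and>
          x (Suc i) + 2 * int N = x i + 2 * int N + 1) \<or>
        (prev_letter (w i) = letter_c \<and> R (y i) (x i + 2 * int N) \<and> y (Suc i) = y i + 1 \<and> z (Suc i) = z i \<and>
          x (Suc i) + 2 * int N = x i + 2 * int N + 1)"
    using run_step[OF assms, of i] R_sym R_period' by (elim disjE) auto
qed (use run_bounds[OF assms] run_period[OF assms] in auto)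

lemma run_translate:
  assumes "run w x y z"
  shows "run w (\<lambda>i. x i + 2 * int N * k) (\<lambda>i. y i + 2 * int N * k) (\<lambda>i. z i + 2 * int N * k)"
proof -
  have "R (p + 2 * int N * k) (q + 2 * int N * k) \<longleftrightarrow> R p q" for p q
    using R_cong[of "p + 2 * int N * k" p] R_cong'[of "q + 2 * int N * k" q] by simp
  then show ?thesis
    using assms unfolding run_def by simp
qed

text \<open>The three cut points lie within one turn, where partners are unique, so a chord between
  two of them leaves no chord to the third.\<close>

lemma run_a:
  assumes "run w x y z" "R (x i) (y i)"
  shows "w i = letter_a" "x (Suc i) = x i + 1" "y (Suc i) = y i + 1" "z (Suc i) = z i"
proof -
  note b = run_bounds[OF assms(1), of i]
  have "\<not> R (y i) (z i)"
    using R_partner_eq[of "y i" "x i + 2 * int N" "z i"] assms(2) R_sym R_period' b by force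
  moreover have "\<not> R (x i) (z i)"
    using R_partner_eq[of "x i" "y i" "z i"] assms(2) b by force
  ultimately show "w i = letter_a" "x (Suc i) = x i + 1" "y (Suc i) = y i + 1" "z (Suc i) = z i"
    using run_step[OF assms(1), of i] by auto
qed

lemma run_as:
  assumes "run w x y z" and "\<forall>t<n. R (x i + int t) (y i + int t)"
  shows "x (i + n) = x i + int n \<and> y (i + n) = y i + int n \<and> z (i + n) = z i \<and>
    (\<forall>t<n. w (i + t) = letter_a)"
  using assms(2)
proof (induction n)
  case (Suc n)
  then show ?case
    using run_a[OF assms(1), of "i + n"] by (auto simp: less_Suc_eq)
qed simp

lemma run_letter:
  assumes "run w x y z"
  shows "w i \<in> {letter_a, letter_b, letter_c}"
  using run_step[OF assms, of i] by auto

lemma prev_letter_eq: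
  assumes "l \<in> {letter_a, letter_b, letter_c}"
  shows "prev_letter l = letter_a \<longleftrightarrow> l = letter_b" "prev_letter (prev_letter l) = letter_a \<longleftrightarrow> l = letter_c"
  using assms by auto

lemma run_bs:
  assumes "run w x y z" and "\<forall>t<n. R (y i + int t) (z i + int t)"
  shows "x (i + n) = x i \<and> y (i + n) = y i + int n \<and> z (i + n) = z i + int n \<and>
    (\<forall>t<n. w (i + t) = letter_b)"
  using run_as[OF run_rotate[OF assms(1)] assms(2)] prev_letter_eq(1) run_letter[OF assms(1)] by auto

lemma run_cs:
  assumes "run w x y z" and "\<forall>t<n. R (x i + int t) (z i + int t)"
  shows "x (i + n) = x i + int n \<and> y (i + n) = y i \<and> z (i + n) = z i + int n \<and>
    (\<forall>t<n. w (i + t) = letter_c)"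
proof -
  have "R (z i + int t) (x i + 2 * int N + int t)" if "t < n" for t
    using assms(2) that R_sym R_period'[of _ "x i + int t"] by (simp add: algebra_simps)
  then show ?thesis
    using run_as[OF run_rotate[OF run_rotate[OF assms(1)]], of n i] prev_letter_eq(2) run_letter[OF assms(1)]
    by auto
qed

text \<open>A strand stands still until another strand reaches the partner of its next point.\<close>

lemma run_wait_x:
  assumes "run w x y z" "R (x i) Q" "x i < Q" "Q < x i + 2 * int N"
  obtains m where "\<forall>t<m. R (y i + int t) (z i + int t)" "y i + int m = Q \<or> z i + int m = Q"
proof -
  \<comment> \<open>Otherwise strand 1 would never move, although after \<open>N\<close> steps it
    stands at \<open>y i\<close>, beyond \<open>x i\<close>.\<close>
  have "\<exists>m. w (i + m) \<noteq> letter_b"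
  proof (rule ccontr)
    assume "\<not> ?thesis"
    then have *: "w (i + m) = letter_b" for m
      by blast
    have "x (i + m) = x i" for m
    proof (induction m)
      case (Suc m)
      then show ?case
        using run_step[OF assms(1), of "i + m"] *[of m] by simp
    qed simp
    then show False
      using run_period(2)[OF assms(1), of i] run_bounds(1)[OF assms(1), of i] by force
  qed
  then have "\<exists>m. w (i + m) \<noteq> letter_b \<and> (\<forall>t<m. \<not> w (i + t) \<noteq> letter_b)"
    by (subst (asm) exists_least_iff)
  then obtain m where m: "w (i + m) \<noteq> letter_b" "\<And>t. t < m \<Longrightarrow> w (i + t) = letter_b"
    by blast
  have pos: "x (i + t) = x i \<and> y (i + t) = y i + int t \<and> z (i + t) = z i + int t" if "t \<le> m" for t
    using that
  proof (induction t)
    case (Suc t)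
    then show ?case
      using run_step[OF assms(1), of "i + t"] m(2)[of t] by simp
  qed simp
  have R: "\<forall>t<m. R (y i + int t) (z i + int t)"
  proof (intro allI impI)
    fix t assume "t < m"
    then show "R (y i + int t) (z i + int t)"
      using pos[of t] m(2)[of t] run_step[OF assms(1), of "i + t"] by simp
  qed
  have "R (x i) (y (i + m)) \<or> R (x i) (z (i + m))"
    using pos[of m] run_step[OF assms(1), of "i + m"] m(1) by auto
  then have "y (i + m) = Q \<or> z (i + m) = Q"
  proof
    assume "R (x i) (y (i + m))"
    then show ?thesis
      using R_partner_eq[OF _ assms(2)] run_bounds[OF assms(1), of "i + m"] assms(3,4) pos[of m] by auto
  next
    assume "R (x i) (z (i + m))"
    then show ?thesis
      using R_partner_eq[OF _ assms(2)] run_bounds[OF assms(1), of "i + m"] assms(3,4) pos[of m] by auto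
  qed
  then show ?thesis
    using that R pos[of m] by auto
qed

lemma run_wait_y:
  assumes "run w x y z" "R (y i) Q" "y i < Q" "Q < y i + 2 * int N"
  obtains m where "\<forall>t<m. R (x i + int t) (z i + int t)"
    "z i + int m = Q \<or> x i + 2 * int N + int m = Q"
proof -
  obtain m where m: "\<forall>t<m. R (z i + int t) (x i + 2 * int N + int t)"
    "z i + int m = Q \<or> x i + 2 * int N + int m = Q"
    using run_wait_x[OF run_rotate[OF assms(1)] assms(2-4)] by blast
  have "R (x i + int t) (z i + int t)" if "t < m" for t
    using m(1) that R_sym R_period'[of "z i + int t" "x i + int t"] by (simp add: algebra_simps)
  then show ?thesis
    using that m(2) by blast
qed

text \<open>Strand 2 waits at \<open>q\<close> for \<open>v\<close>, so strands 1 and 3 pass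
  parallel chords until strand 1 reaches \<open>v\<close> or strand 3 reaches
  \<open>v + 2 * int N\<close>. The chord just before \<open>p\<close> and \<open>q\<close> rules
  out the second outcome.\<close>

lemma run_gap:
  assumes X: "run w x y z" and st: "x i = p" "y i = q" "z i = r"
    and prev: "R (p - 1) (q - 1)" and pr: "R p r" and qv: "R q v" and v: "p < v" "v < q"
  shows "\<forall>t<nat (v - p). R (p + int t) (r + int t)"
proof -
  note b = run_bounds[OF X, of i, unfolded st]
  obtain m where m: "\<forall>t<m. R (p + int t) (r + int t)"
    "r + int m = v + 2 * int N \<or> p + 2 * int N + int m = v + 2 * int N"
    using run_wait_y[OF X, of i "v + 2 * int N"] qv v b R_period' unfolding st by auto
  have "r + int m \<noteq> v + 2 * int N"
  proof
    assume rm: "r + int m = v + 2 * int N"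
    \<comment> \<open>At time \<open>t\<close> strand 3 would stand at
      \<open>p - 1 + 2 * int N\<close>, and strand 1 therefore at its partner
      \<open>q - 1\<close>.\<close>
    define t where "t = nat (p - 1 + 2 * int N - r)"
    have t: "int t = p - 1 + 2 * int N - r" "t < m"
      using b v rm by (auto simp: t_def)
    then have "R (p + int t) (p - 1 + 2 * int N)"
      using m(1) by (metis add.commute diff_add_cancel)
    then have "R (p - 1) (p + int t)"
      using R_sym R_period' by blast
    then have e: "p + int t = q - 1"
      using R_partner_eq[OF prev, of "p + int t"] t b by force
    \<comment> \<open>On its way there strand 1 would have passed \<open>v\<close> against a point
      of strand 3; comparing that point with the true partner \<open>q\<close> contradicts the order
      of the cut points.\<close>
    define t' where "t' = nat (v - p)"
    have t': "int t' = v - p" "t' < m"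
      using b v rm e t by (auto simp: t'_def)
    then have "R v (r + v - p)"
      using m(1) by (metis add.commute diff_add_cancel diff_add_eq)
    moreover have "r + v - p = v + p - q + 2 * int N"
      using e t by simp
    ultimately have "R v (v + p - q)"
      using R_period' by metis
    moreover have "R v (q - 2 * int N)"
      using R_period'[of v "q - 2 * int N"] R_sym[OF qv] by simp
    moreover have "\<bar>v + p - q - (q - 2 * int N)\<bar> < 2 * int N"
      using v b e t by linarith
    ultimately have "v + p - q = q - 2 * int N"
      by (rule R_partner_eq)
    then show False
      using v b e t by simp
  qed
  with m v show ?thesis
    by auto
qed

end

section \<open>Words read off from runs\<close>

definition word_at :: "nat \<Rightarrow> (nat \<Rightarrow> letter) \<Rightarrow> nat \<Rightarrow> letter list" where
  "word_at N w i = map w [i..<i + N]"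

lemma map_upt_replicate:
  "(\<forall>t<n. w (i + t) = l) \<Longrightarrow> map w [i..<i + n] = replicate n l"
  by (auto simp: list_eq_iff_nth_eq)

lemma word_at_three_blocks:
  assumes "\<forall>t<k. w (i + t) = l" "\<forall>t<m. w (i + k + t) = l'" "\<forall>t<n. w (i + k + m + t) = l''"
    and "N = k + m + n"
  shows "word_at N w i = replicate k l @ replicate m l' @ replicate n l''"
proof -
  have "[i..<i + N] = [i..<i + k] @ [i + k..<i + k + m] @ [i + k + m..<i + k + m + n]"
    using upt_add_eq_append[of i "i + k" "m + n"] upt_add_eq_append[of "i + k" "i + k + m" n] assms(4)
    by (simp add: add.assoc)
  then show ?thesis
    using map_upt_replicate[OF assms(1)] map_upt_replicate[OF assms(2)] map_upt_replicate[OF assms(3)]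
    by (simp add: word_at_def)
qed

context chord_line
begin

text \<open>Advancing the window drops its first letter and appends the \<open>prev_letter\<close>
  of it, which is an inverse cyclic permutation.\<close>

lemma word_at_Suc:
  assumes "run w x y z"
  shows "cyclically_equivalent (word_at N w (Suc i)) (word_at N w i)"
proof -
  have "[i..<i + N] = i # [Suc i..<i + N]"
    using N_pos by (simp add: upt_conv_Cons)
  moreover have "[Suc i..<Suc i + N] = [Suc i..<i + N] @ [i + N]"
    using N_pos by simp
  ultimately show ?thesis
    using cyclically_equivalent_step[OF run_letter[OF assms]] run_period(1)[OF assms]
    unfolding word_at_def by simp
qed

lemma word_at_add:
  assumes "run w x y z"
  shows "cyclically_equivalent (word_at N w i) (word_at N w (i + k))"
proof (induction k)
  case (Suc k)
  then show ?case
    using cyclically_equivalent_sym[OF word_at_Suc[OF assms, of "i + k"]]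
    by (auto intro: cyclically_equivalent_trans)
qed simp

lemma word_at_any:
  assumes "run w x y z"
  shows "cyclically_equivalent (word_at N w i) (word_at N w j)"
  using word_at_add[OF assms, of 0 i] word_at_add[OF assms, of 0 j]
  by (auto intro: cyclically_equivalent_trans cyclically_equivalent_sym)

section \<open>Comparison of two runs\<close>

text \<open>Both runs have cut points at \<open>p\<close> and \<open>q\<close>; the remaining one
  lies beyond \<open>q\<close> in the first run and between \<open>p\<close> and \<open>q\<close> in
  the second. Waiting strands then determine every chord: the circle is cut into arcs of lengths
  \<open>m\<close>, \<open>n\<close>, \<open>k\<close> from \<open>p\<close> to \<open>q\<close> and
  \<open>n\<close>, \<open>m\<close>, \<open>k\<close> from \<open>q\<close> back to
  \<open>p\<close>, and arcs of the same name are joined in parallel.\<close>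

lemma runs_disagree_core:
  assumes X: "run w x y z" and Y: "run w' u v s"
    and Xi: "x i = p" "y i = q" and Yj: "u j = p" "s j = q"
    and prev: "R (p - 1) (q - 1)" and pq: "\<not> R p q"
  obtains k m n where "0 < k" "0 < m" "0 < n"
    "word_at N w i = replicate m letter_c @ replicate n letter_a @ replicate k letter_c"
    "word_at N w' j = replicate n letter_b @ replicate m letter_c @ replicate k letter_b"
proof -
  define r where "r = z i"
  define c where "c = v j"
  have b: "p < q" "q < r" "r < p + 2 * int N" "p < c" "c < q"
    using run_bounds[OF X, of i] run_bounds[OF Y, of j] Xi Yj by (auto simp: r_def c_def)
  have sX: "R p r \<or> R q r"
    using run_step[OF X, of i] Xi pq by (auto simp: r_def)
  have sY: "R p c \<or> R q c"
    using run_step[OF Y, of j] Yj pq R_sym by (auto simp: c_def)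
  have "\<not> R p c"
  proof
    assume pc: "R p c"
    then have "\<not> R p r"
      using R_partner_eq[of p c r] b by linarith
    then have "R q r"
      using sX by blast
    \<comment> \<open>Strand 1 of the first run would wait for \<open>c\<close>, but the other two
      cut points already lie beyond \<open>c\<close> and only move forward.\<close>
    obtain m where "q + int m = c \<or> r + int m = c"
      using run_wait_x[OF X, of i c] pc b Xi by (auto simp: r_def)
    then show False
      using b by linarith
  qed
  then have qc: "R q c"
    using sY by blast
  then have "\<not> R q r"
    using R_partner_eq[of q c r] b by linarith
  then have pr: "R p r"
    using sX by blast
  define m where "m = nat (c - p)"
  define n where "n = nat (r - q)"
  have mn: "0 < m" "0 < n" "c = p + int m" "r = q + int n"
    using b by (auto simp: m_def n_def)
  have Rm: "\<forall>t<m. R (p + int t) (r + int t)"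
    unfolding m_def using run_gap[OF X Xi r_def[symmetric] prev pr qc] b by simp
  \<comment> \<open>Strand 1 of the second run waits at \<open>p\<close> for \<open>r\<close>. Two
    rotations bring this to the form of \<open>run_gap\<close>, with cut points \<open>q\<close>,
    \<open>p + 2 * int N\<close> and \<open>c + 2 * int N\<close>.\<close>
  have "\<forall>t<nat (r - q). R (q + int t) (c + 2 * int N + int t)"
  proof (rule run_gap[OF run_rotate[OF run_rotate[OF Y]]])
    show "R (q - 1) (p + 2 * int N - 1)"
      using R_sym[OF prev] R_period'[of "q - 1" "p - 1"] by (simp add: algebra_simps)
  qed (use Yj b pr qc R_period R_period' in \<open>auto simp: c_def\<close>)
  then have Rn: "\<forall>t<n. R (c + int t) (q + int t)"
    using R_period'[of _ "c + int _"] R_sym by (auto simp: n_def algebra_simps)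
  have X1: "x (i + m) = c" "y (i + m) = q" "z (i + m) = r + int m" "\<forall>t<m. w (i + t) = letter_c"
    using run_cs[OF X, of m i] Rm Xi mn by (auto simp: r_def)
  have X2: "x (i + m + n) = c + int n" "y (i + m + n) = r" "z (i + m + n) = r + int m"
    "\<forall>t<n. w (i + m + t) = letter_a"
    using run_as[OF X, of n "i + m"] X1 Rn mn by auto
  note b2 = run_bounds[OF X, of "i + m + n", unfolded X2]
  obtain k where k: "\<forall>t<k. R (c + int n + int t) (r + int m + int t)"
    "r + int m + int k = p + 2 * int N \<or> c + int n + 2 * int N + int k = p + 2 * int N"
    using run_wait_y[OF X, of "i + m + n" "p + 2 * int N"] R_sym[OF pr] R_period' b
    unfolding X2 by auto
  then have k': "r + int m + int k = p + 2 * int N"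
    using b by auto
  have X3: "x (i + m + n + k) = c + int n + int k" "y (i + m + n + k) = r"
    "z (i + m + n + k) = p + 2 * int N" "\<forall>t<k. w (i + m + n + t) = letter_c"
    using run_cs[OF X, of k "i + m + n"] k X2 k' by auto
  note b3 = run_bounds[OF X, of "i + m + n + k", unfolded X3]
  \<comment> \<open>Without a third block the point before \<open>p\<close> would end the first
    block, and its partner would be \<open>c - 1\<close> instead of \<open>q - 1\<close>.\<close>
  have "0 < k"
  proof (rule ccontr)
    assume "\<not> 0 < k"
    then have "r + int (m - 1) = p - 1 + 2 * int N"
      using k' mn by simp
    moreover have "R (p + int (m - 1)) (r + int (m - 1))"
      using mn(1) by (intro Rm[rule_format]) simp
    ultimately have "R (p - 1) (p + int (m - 1))"
      using R_period' R_sym by metis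
    then have "p + int (m - 1) = q - 1"
      using R_partner_eq[OF prev, of "p + int (m - 1)"] mn b by (simp add: of_nat_diff)
    then show False
      using mn b by (simp add: of_nat_diff)
  qed
  then have "r + int m + int (k - 1) = p - 1 + 2 * int N"
    using k' by simp
  moreover have "R (c + int n + int (k - 1)) (r + int m + int (k - 1))"
    using \<open>0 < k\<close> by (intro k(1)[rule_format]) simp
  ultimately have "R (p - 1) (c + int n + int (k - 1))"
    using R_period' R_sym by metis
  \<comment> \<open>The third block ends with the chord joining \<open>p - 1\<close> and
    \<open>q - 1\<close>, so the blocks fill the whole circle.\<close>
  then have "c + int n + int (k - 1) = q - 1"
    using R_partner_eq[OF prev, of "c + int n + int (k - 1)"] mn b b3 \<open>0 < k\<close> by (simp add: of_nat_diff)
  then have q: "q = c + int n + int k"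
    using \<open>0 < k\<close> by (simp add: of_nat_diff)
  have Nmnk: "N = m + n + k"
    using q k' mn by simp
  have Y1: "u (j + n) = p" "v (j + n) = c + int n" "s (j + n) = r" "\<forall>t<n. w' (j + t) = letter_b"
    using run_bs[OF Y, of n j] Rn Yj mn by (auto simp: c_def)
  have Y2: "u (j + n + m) = c" "v (j + n + m) = c + int n" "s (j + n + m) = r + int m"
    "\<forall>t<m. w' (j + n + t) = letter_c"
    using run_cs[OF Y, of m "j + n"] Rm Y1 mn by auto
  have Y3: "\<forall>t<k. w' (j + n + m + t) = letter_b"
    using run_bs[OF Y, of k "j + n + m"] k(1) Y2 by auto
  show ?thesis
    using that[OF \<open>0 < k\<close> mn(1,2)] word_at_three_blocks[OF X1(4) X2(4) X3(4)]
      word_at_three_blocks[OF Y1(4) Y2(4) Y3] Nmnk by simp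
qed

lemma exists_parallel_break:
  assumes "\<not> parallel" "R p q"
  obtains K where "\<forall>t<K. R (p + int t) (q + int t)" "\<not> R (p + int K) (q + int K)" "0 < K"
proof -
  have "\<exists>K. \<not> R (p + int K) (q + int K)"
    using parallelI assms(1) by blast
  then have "\<exists>K. \<not> R (p + int K) (q + int K) \<and> (\<forall>t<K. \<not> \<not> R (p + int t) (q + int t))"
    by (subst (asm) exists_least_iff)
  then obtain K where "\<not> R (p + int K) (q + int K)" "\<forall>t<K. R (p + int t) (q + int t)"
    by blast
  moreover from this have "0 < K"
    using assms(2) by (cases K) auto
  ultimately show ?thesis
    using that by blast
qed

text \<open>Alternative (ii) of the theorem; the name recalls the flypes of closed 3-braids, which
  exchange exponents in the same way.\<close>

definition flype_related :: "letter list \<Rightarrow> letter list \<Rightarrow> bool" where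
  "flype_related V W \<longleftrightarrow> (\<exists>l m n :: nat. 0 < l \<and> 0 < m \<and> 0 < n \<and>
     cyclically_equivalent V (replicate l letter_a @ replicate m letter_c @ replicate n letter_a) \<and>
     cyclically_equivalent W (replicate l letter_a @ replicate n letter_c @ replicate m letter_a))"

lemma runs_disagree:
  assumes X: "run w x y z" and Y: "run w' u v s" and np: "\<not> parallel"
    and Xi: "x i = p" "y i = q" and Yj: "u j = p" "s j = q" and pq: "R p q"
  shows "flype_related (word_at N w i) (word_at N w' j)"
proof -
  obtain K where K: "\<forall>t<K. R (p + int t) (q + int t)" "\<not> R (p + int K) (q + int K)" "0 < K"
    using exists_parallel_break[OF np pq] .
  have last: "R (p + int K - 1) (q + int K - 1)"
    using K(1)[rule_format, of "K - 1"] K(3) by (simp add: of_nat_diff algebra_simps)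
  have "x (i + K) = p + int K" "y (i + K) = q + int K"
    using run_as[OF X, of K i] K(1) Xi by auto
  moreover have "u (j + K) = p + int K" "s (j + K) = q + int K"
    using run_cs[OF Y, of K j] K(1) Yj by auto
  ultimately obtain k m n where kmn: "0 < k" "0 < m" "0 < n"
    "word_at N w (i + K) = replicate m letter_c @ replicate n letter_a @ replicate k letter_c"
    "word_at N w' (j + K) = replicate n letter_b @ replicate m letter_c @ replicate k letter_b"
    using runs_disagree_core[OF X Y _ _ _ _ last K(2)] by metis
  have "cyclically_equivalent (word_at N w (i + K))
      (replicate k letter_a @ replicate m letter_c @ replicate n letter_a)"
    using cyclically_equivalent_append[of "replicate k letter_a" "replicate m letter_c @ replicate n letter_a"]
      kmn(4) by (auto simp: set_replicate_conv_if split: if_splits)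
  moreover have "cyclically_equivalent (word_at N w' (j + K))
      (replicate k letter_a @ replicate n letter_c @ replicate m letter_a)"
  proof -
    have "cyclically_equivalent (word_at N w' (j + K))
        (replicate k letter_c @ replicate n letter_b @ replicate m letter_c)"
      using cyclically_equivalent_append[of "replicate k letter_c" "replicate n letter_b @ replicate m letter_c"]
        kmn(5) by (auto simp: set_replicate_conv_if split: if_splits)
    \<comment> \<open>With an empty rest every letter is moved once, which relabels the whole word
      and keeps the order of its letters.\<close>
    also have "cyclically_equivalent \<dots> (replicate k letter_a @ replicate n letter_c @ replicate m letter_a)"
      using cyclically_equivalent_append[of
          "replicate k letter_a @ replicate n letter_c @ replicate m letter_a" "[]"]
      by (auto simp: set_replicate_conv_if split: if_splits)
    finally show ?thesis .
  qed
  ultimately show ?thesis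
    unfolding flype_related_def using kmn(1-3) word_at_add[OF X, of i K] word_at_add[OF Y, of j K]
    by (meson cyclically_equivalent_trans)
qed

text \<open>At most one pair of the three next points can form a chord, so a state determines the
  next step.\<close>

lemma runs_eq_forward:
  assumes X: "run w x y z" and Y: "run w' u v s"
    and "x i = u j" "y i = v j" "z i = s j"
  shows "x (i + t) = u (j + t) \<and> y (i + t) = v (j + t) \<and> z (i + t) = s (j + t)"
proof (induction t)
  case (Suc t)
  note b = run_bounds[OF X, of "i + t"]
  let ?x = "x (i + t)" and ?y = "y (i + t)" and ?z = "z (i + t)"
  have *: "\<not> (R ?x ?y \<and> R ?x ?z)" "\<not> (R ?x ?y \<and> R ?y ?z)" "\<not> (R ?x ?z \<and> R ?y ?z)"
    using R_partner_eq[of ?x ?y ?z] R_partner_eq[of ?y "?x + 2 * int N" ?z] R_partner_eq[of ?z ?x ?y]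
      R_sym R_period' b by fastforce+
  show ?case
    using run_step[OF X, of "i + t"] run_step[OF Y, of "j + t"] Suc * by auto
qed (use assms in simp)

lemma runs_eq_word:
  assumes X: "run w x y z" and Y: "run w' u v s"
    and "x i = u j" "y i = v j" "z i = s j"
  shows "word_at N w i = word_at N w' j"
proof -
  have "w (i + t) = w' (j + t)" for t
    using runs_eq_forward[OF assms, of t] runs_eq_forward[OF assms, of "Suc t"]
      run_step[OF X, of "i + t"] run_step[OF Y, of "j + t"] by auto
  then show ?thesis
    by (auto simp: word_at_def list_eq_iff_nth_eq)
qed

lemma flype_related_sym: "flype_related V W \<Longrightarrow> flype_related W V"
  unfolding flype_related_def by blast

lemma flype_related_cong:
  assumes "flype_related V W" "cyclically_equivalent V V'" "cyclically_equivalent W W'"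
  shows "flype_related V' W'"
  using assms unfolding flype_related_def
  by (meson cyclically_equivalent_sym cyclically_equivalent_trans)

lemma runs_disagree_any:
  assumes "run w x y z" "run w' u v s" "\<not> parallel"
    and "x i = p" "y i = q" "u j = p" "s j = q" "R p q"
  shows "flype_related (word_at N w 0) (word_at N w' 0)"
  using flype_related_cong[OF runs_disagree[OF assms]] word_at_any assms(1,2) by blast

text \<open>The two runs leave a common block of parallel chords differently, and by the time the
  second one reaches the chord at \<open>p\<close> they traverse it in opposite directions.\<close>

lemma runs_agree_split:
  assumes X: "run w x y z" and Y: "run w' u v s" and np: "\<not> parallel"
    and Xi: "x i = p" "y i = q" and Yj: "u j = p" "v j = q"
    and pr: "R p (z i)" and qs: "R q (s j)"
  shows "flype_related (word_at N w 0) (word_at N w' 0)"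
proof -
  have b: "p < q" "q < z i" "z i < p + 2 * int N" "q < s j" "s j < p + 2 * int N"
    using run_bounds[OF X, of i] run_bounds[OF Y, of j] Xi Yj by auto
  have "z i \<noteq> s j"
    using R_partner_eq[of "z i" p q] R_sym pr qs b by fastforce
  \<comment> \<open>Strand 2 of the first run waits at \<open>q\<close> for \<open>s j\<close>.
    Strand 1, one turn further, is already beyond it, so strand 3 must get there, and
    \<open>z i\<close> comes before \<open>s j\<close>.\<close>
  moreover obtain m where "z i + int m = s j \<or> p + 2 * int N + int m = s j"
    using run_wait_y[OF X, of i "s j"] qs b Xi by auto
  ultimately have "z i < s j"
    using b by auto
  \<comment> \<open>Strand 1 of the second run waits at \<open>p\<close> for \<open>z i\<close>.
    Strand 3 is already beyond it, so strand 2 gets there; the first run has this chord on strands 1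
    and 3 instead.\<close>
  obtain n where n: "\<forall>t<n. R (q + int t) (s j + int t)" "q + int n = z i \<or> s j + int n = z i"
    using run_wait_x[OF Y, of j "z i"] pr b Yj by auto
  then have "q + int n = z i"
    using \<open>z i < s j\<close> by auto
  then have "u (j + n) = p" "v (j + n) = z i"
    using run_bs[OF Y, of n j] n(1) Yj by auto
  then show ?thesis
    using runs_disagree_any[OF Y X np] Xi pr flype_related_sym by blast
qed

text \<open>When the common block ends, both runs must use their third strand. If it meets the same
  end in both, uniqueness of partners makes the states equal; otherwise
  \<open>runs_agree_split\<close> applies.\<close>

lemma runs_agree:
  assumes X: "run w x y z" and Y: "run w' u v s" and np: "\<not> parallel"
    and Xi: "x i = p" "y i = q" and Yj: "u j = p" "v j = q" and pq: "R p q"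
  shows "cyclically_equivalent (word_at N w 0) (word_at N w' 0) \<or>
    flype_related (word_at N w 0) (word_at N w' 0)"
proof -
  obtain K where K: "\<forall>t<K. R (p + int t) (q + int t)" "\<not> R (p + int K) (q + int K)"
    using exists_parallel_break[OF np pq] by metis
  define P where "P = p + int K"
  define Q where "Q = q + int K"
  have XK: "x (i + K) = P" "y (i + K) = Q"
    using run_as[OF X, of K i] K(1) Xi by (auto simp: P_def Q_def)
  have YK: "u (j + K) = P" "v (j + K) = Q"
    using run_as[OF Y, of K j] K(1) Yj by (auto simp: P_def Q_def)
  note bX = run_bounds[OF X, of "i + K", unfolded XK]
  note bY = run_bounds[OF Y, of "j + K", unfolded YK]
  have sX: "R P (z (i + K)) \<or> R Q (z (i + K))"
    using run_step[OF X, of "i + K"] XK K(2) by (auto simp: P_def Q_def)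
  have sY: "R P (s (j + K)) \<or> R Q (s (j + K))"
    using run_step[OF Y, of "j + K"] YK K(2) by (auto simp: P_def Q_def)
  have same: ?thesis if "z (i + K) = s (j + K)"
  proof -
    have "word_at N w (i + K) = word_at N w' (j + K)"
      using runs_eq_word[OF X Y] XK YK that by simp
    then show ?thesis
      using word_at_any[OF X, of 0 "i + K"] word_at_any[OF Y, of "j + K" 0]
      by (auto intro: cyclically_equivalent_trans)
  qed
  consider "R P (z (i + K))" "R P (s (j + K))" | "R Q (z (i + K))" "R Q (s (j + K))"
    | "R P (z (i + K))" "R Q (s (j + K))" | "R Q (z (i + K))" "R P (s (j + K))"
    using sX sY by blast
  then show ?thesis
  proof cases
    case 1
    then show ?thesis
      using R_partner_eq[of P] bX bY by (intro same) auto
  next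
    case 2
    then show ?thesis
      using R_partner_eq[of Q] bX bY by (intro same) auto
  next
    case 3
    then show ?thesis
      using runs_agree_split[OF X Y np XK YK] by blast
  next
    case 4
    then show ?thesis
      using runs_agree_split[OF Y X np YK XK] flype_related_sym by blast
  qed
qed

text \<open>Strand 1 advances by a full turn in \<open>3 * N\<close> steps and by at most one point
  in each, so it passes every point from its start on.\<close>

lemma run_passes:
  assumes X: "run w x y z" and "x 0 \<le> p"
  obtains j where "x j = p" "R p (y j) \<or> R p (z j)"
proof -
  have *: "x (i + N + N + N) = x i + 2 * int N" for i
    using run_period[OF X] by simp
  have "x ((N + N + N) * k) = x 0 + 2 * int N * int k" for k
  proof (induction k)
    case (Suc k)
    then show ?case
      using *[of "(N + N + N) * k"] by (simp add: algebra_simps)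
  qed simp
  moreover define e where "e = p - x 0 + 1"
  ultimately have "x ((N + N + N) * nat e) = x 0 + 2 * int N * e"
    using assms(2) by (simp add: e_def)
  moreover have "e \<le> 2 * int N * e"
    using mult_right_mono[of 1 "2 * int N" e] N_pos assms(2) by (simp add: e_def)
  ultimately have "x ((N + N + N) * nat e) > p"
    unfolding e_def by linarith
  then have "\<exists>j. x j > p"
    by blast
  then have "\<exists>j. x j > p \<and> (\<forall>t<j. \<not> x t > p)"
    by (subst (asm) exists_least_iff)
  then obtain j where j: "x j > p" "\<And>t. t < j \<Longrightarrow> x t \<le> p"
    by (auto simp: not_less)
  then obtain i where i: "j = Suc i"
    using assms(2) by (cases j) auto
  then have "x i = p" "R p (y i) \<or> R p (z i)"
    using j(1) j(2)[of i] run_step[OF X, of i] by auto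
  then show ?thesis
    using that by blast
qed

text \<open>Take a chord that the first run passes on strands 1 and 2. Strand 1 of the second run
  also passes its end \<open>x i\<close>, and the other end is then on strand 2 or strand 3: these
  are the two cases compared above.\<close>

lemma runs_equivalent:
  assumes X: "run w x y z" and Y: "run w' u v s" and np: "\<not> parallel"
  shows "cyclically_equivalent (word_at N w 0) (word_at N w' 0) \<or>
    flype_related (word_at N w 0) (word_at N w' 0)"
proof -
  have "w 0 = letter_a \<or> w (0 + N) = letter_a \<or> w (0 + N + N) = letter_a"
    using run_letter[OF X, of 0] unfolding run_period(1)[OF X] by auto
  then obtain i where "w i = letter_a"
    by blast
  then have i: "R (x i) (y i)"
    using run_step[OF X, of i] by auto
  \<comment> \<open>The number of turns by which the second run is moved so that it starts at or
    before \<open>x i\<close>.\<close>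
  define k where "k = (x i - u 0) div (2 * int N)"
  have "2 * int N * k \<le> x i - u 0"
    using N_pos unfolding k_def
    by (metis add.commute le_add_same_cancel1 mult_div_mod_eq of_nat_0_less_iff
        pos_mod_sign zero_less_mult_iff zero_less_numeral)
  then have "u 0 + 2 * int N * k \<le> x i"
    by simp
  note Y' = run_translate[OF Y, of k]
  obtain j where j: "u j + 2 * int N * k = x i"
    "R (x i) (v j + 2 * int N * k) \<or> R (x i) (s j + 2 * int N * k)"
    using run_passes[OF Y' \<open>u 0 + 2 * int N * k \<le> x i\<close>] by blast
  note b = run_bounds[OF X, of i] run_bounds[OF Y', of j]
  show ?thesis
    using j(2)
  proof
    assume "R (x i) (v j + 2 * int N * k)"
    then have "v j + 2 * int N * k = y i"
      using R_partner_eq[OF _ i] b j(1) by auto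
    then show ?thesis
      using runs_agree[OF X Y' np refl refl j(1) _ i] by blast
  next
    assume "R (x i) (s j + 2 * int N * k)"
    then have "s j + 2 * int N * k = y i"
      using R_partner_eq[OF _ i] b j(1) by auto
    then show ?thesis
      using runs_disagree_any[OF X Y' np refl refl j(1) _ i] by blast
  qed
qed

text \<open>If two cut points coincide, one strand carries no chord; then all letters are equal and all
  chords are parallel.\<close>

lemma run_if_no_ties:
  fixes w :: "nat \<Rightarrow> letter" and x y z :: "nat \<Rightarrow> int"
  assumes step: "\<And>i. (w i = letter_a \<and> R (x i) (y i) \<and> x (Suc i) = x i + 1 \<and> y (Suc i) = y i + 1 \<and> z (Suc i) = z i) \<or>
         (w i = letter_b \<and> R (y i) (z i) \<and> x (Suc i) = x i \<and> y (Suc i) = y i + 1 \<and> z (Suc i) = z i + 1) \<or>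
         (w i = letter_c \<and> R (x i) (z i) \<and> x (Suc i) = x i + 1 \<and> y (Suc i) = y i \<and> z (Suc i) = z i + 1)"
    and le: "\<And>i. x i \<le> y i" "\<And>i. y i \<le> z i" "\<And>i. z i \<le> x i + 2 * int N"
    and period: "\<And>i. w (i + N) = prev_letter (w i)" "\<And>i. x (i + N) = y i" "\<And>i. y (i + N) = z i"
      "\<And>i. z (i + N) = x i + 2 * int N"
    and np: "\<not> parallel"
  shows "run w x y z"
proof -
  have yz: "y i \<noteq> z i" for i
  proof
    assume tie: "y i = z i"
    have "y j \<le> y (Suc j)" for j
      using step[of j] by auto
    then have "mono y"
      by (rule incseq_SucI)
    \<comment> \<open>Because of the tie, strand 2 ends the window where it began and hence never
      moves: every letter is \<open>letter_c\<close>.\<close>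
    have y: "y (i + t) = y i" if "t \<le> N" for t
      using monoD[OF \<open>mono y\<close>, of i "i + t"] monoD[OF \<open>mono y\<close>, of "i + t" "i + N"] that tie period(3)[of i]
      by simp
    have st: "R (x (i + t)) (z (i + t)) \<and> x (Suc (i + t)) = x (i + t) + 1 \<and> z (Suc (i + t)) = z (i + t) + 1"
      if "t < N" for t
      using step[of "i + t"] y[of t] y[of "Suc t"] that by auto
    have xz: "x (i + t) = x i + int t \<and> z (i + t) = z i + int t" if "t \<le> N" for t
      using that
    proof (induction t)
      case (Suc t)
      then show ?case
        using st[of t] by simp
    qed simp
    have "z i = x i + int N"
      using xz[of N] period(2)[of i] tie by simp
    then have "\<forall>t<N. R (x i + int t) (x i + int N + int t)"
      using st xz by (metis less_imp_le_nat)
    then show False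
      using np unfolding parallel_def by blast
  qed
  \<comment> \<open>The other two ties turn into this one after \<open>2 * N\<close> and
    \<open>N\<close> steps.\<close>
  have "x i \<noteq> y i" for i
    using yz[of "i + N + N"] period by auto
  moreover have "z i \<noteq> x i + 2 * int N" for i
    using yz[of "i + N"] period by auto
  ultimately show ?thesis
    unfolding run_def using step le period yz by (metis order_less_le)
qed

end

section \<open>Chords on the circle\<close>

text \<open>Indices are read modulo the number of chord ends, which unrolls the circle; this will be
  the relation of a \<open>chord_line\<close>.\<close>

definition label_chord :: "nat list \<Rightarrow> int \<Rightarrow> int \<Rightarrow> bool" where
  "label_chord L p q \<longleftrightarrow>
     p mod int (length L) \<noteq> q mod int (length L) \<and>
     L ! nat (p mod int (length L)) = L ! nat (q mod int (length L))"

lemma label_chord_nat: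
  assumes "p < length L" "q < length L"
  shows "label_chord L (int p) (int q) \<longleftrightarrow> p \<noteq> q \<and> L ! p = L ! q"
  using assms by (simp add: label_chord_def)

definition grid_point :: "nat \<Rightarrow> int \<Rightarrow> complex" where
  "grid_point M p = cis (2 * pi * real_of_int p / real M)"

lemma cis_eq_iff: "cis s = cis t \<longleftrightarrow> (\<exists>n::int. s = t + 2 * pi * real_of_int n)"
  using sin_cos_eq_iff[of s t] by (auto simp: complex_eq_iff)

lemma grid_point_eq_iff:
  assumes "0 < M"
  shows "grid_point M p = grid_point M q \<longleftrightarrow> p mod int M = q mod int M"
proof -
  have "grid_point M p = grid_point M q \<longleftrightarrow>
      (\<exists>n::int. 2 * pi * real_of_int p / real M = 2 * pi * real_of_int q / real M + 2 * pi * real_of_int n)"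
    unfolding grid_point_def by (rule cis_eq_iff)
  also have "\<dots> \<longleftrightarrow> (\<exists>n::int. p = q + int M * n)"
  proof (intro ex_cong1)
    fix n :: int
    have "2 * pi * real_of_int p / real M = 2 * pi * real_of_int q / real M + 2 * pi * real_of_int n \<longleftrightarrow>
        2 * pi * real_of_int p = 2 * pi * (real_of_int q + real M * real_of_int n)"
      using assms by (simp add: field_simps)
    also have "\<dots> \<longleftrightarrow> real_of_int p = real_of_int (q + int M * n)"
      by simp
    finally show "2 * pi * real_of_int p / real M = 2 * pi * real_of_int q / real M + 2 * pi * real_of_int n \<longleftrightarrow>
        p = q + int M * n"
      by (simp only: of_int_eq_iff)
  qed
  also have "\<dots> \<longleftrightarrow> p mod int M = q mod int M"
    by (auto simp: mod_eq_dvd_iff dvd_def algebra_simps)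
  finally show ?thesis .
qed

lemma closure_chords_eq:
  assumes "length (closure_labels m W) = M" "0 < M"
  shows "closure_chords m W =
    {{grid_point M p, grid_point M q} | p q. label_chord (closure_labels m W) p q}"
    (is "_ = ?C")
proof -
  define L where "L = closure_labels m W"
  have M: "length L = M"
    using assms by (simp add: L_def)
  have pt: "circle_point M p = grid_point M (int p)" for p
    by (simp add: circle_point_def grid_point_def)
  have "closure_chords m W =
      {{grid_point M (int p), grid_point M (int q)} | p q. p < q \<and> q < M \<and> L ! p = L ! q}"
    unfolding closure_chords_def L_def[symmetric] Let_def M pt ..
  also have "\<dots> = {{grid_point M p, grid_point M q} | p q. label_chord L p q}"
  proof (intro set_eqI iffI; clarify)
    fix p q assume "p < q" "q < M" "L ! p = L ! q"
    then show "\<exists>p' q'. {grid_point M (int p), grid_point M (int q)} = {grid_point M p', grid_point M q'} \<and>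
        label_chord L p' q'"
      using label_chord_nat[of p L q] M by (intro exI[of _ "int p"] exI[of _ "int q"]) auto
  next
    fix p q assume pq: "label_chord L p q"
    define p' where "p' = nat (p mod int M)"
    define q' where "q' = nat (q mod int M)"
    have *: "int p' = p mod int M" "int q' = q mod int M" "p' < M" "q' < M"
      using assms(2) by (auto simp: p'_def q'_def nat_less_iff)
    have g: "grid_point M p = grid_point M (int p')" "grid_point M q = grid_point M (int q')"
      using * grid_point_eq_iff[OF assms(2)] by auto
    have L: "p' \<noteq> q'" "L ! p' = L ! q'"
      using pq *(1,2) unfolding label_chord_def M by (metis, simp add: p'_def q'_def)
    show "\<exists>pa qa. {grid_point M p, grid_point M q} = {grid_point M (int pa), grid_point M (int qa)} \<and>
        pa < qa \<and> qa < M \<and> L ! pa = L ! qa"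
    proof (cases "p' < q'")
      case True
      then show ?thesis
        using g L * by (intro exI[of _ p'] exI[of _ q']) auto
    next
      case False
      then show ?thesis
        using g L * by (intro exI[of _ q'] exI[of _ p']) (auto simp: insert_commute)
    qed
  qed
  finally show ?thesis
    by (simp add: L_def)
qed

lemma filter_upt_nth:
  assumes "P i" "i < n"
  shows "length (filter P [0..<i]) < length (filter P [0..<n])"
    "filter P [0..<n] ! length (filter P [0..<i]) = i"
proof -
  have "[0..<n] = [0..<i] @ i # [Suc i..<n]"
    using assms(2) upt_add_eq_append[of 0 i "n - i"] upt_conv_Cons[of i n] by simp
  then have "filter P [0..<n] = filter P [0..<i] @ i # filter P [Suc i..<n]"
    using assms(1) by simp
  then show "length (filter P [0..<i]) < length (filter P [0..<n])"
    "filter P [0..<n] ! length (filter P [0..<i]) = i"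
    by (simp_all add: nth_append)
qed

lemma filter_upt_index:
  assumes "p < length (filter P [0..<n])"
  obtains i where "P i" "i < n" "p = length (filter P [0..<i])"
proof -
  define i where "i = filter P [0..<n] ! p"
  have "i \<in> set (filter P [0..<n])"
    using assms by (simp add: i_def del: set_filter)
  then have i: "P i" "i < n"
    by auto
  have "p = length (filter P [0..<i])"
    using nth_eq_iff_index_eq[of "filter P [0..<n]" p "length (filter P [0..<i])"]
      filter_upt_nth[of P i n] i assms by (simp add: i_def)
  with i that show ?thesis
    by blast
qed

section \<open>Orientation-preserving homeomorphisms and marked points\<close>

lemma orientation_preserving_homeo_id: "orientation_preserving_homeo (\<lambda>u. u)"
  unfolding orientation_preserving_homeo_def
proof (intro conjI)
  show "\<exists>k. homeomorphism (sphere 0 1) (sphere 0 1) (\<lambda>u :: complex. u) k"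
    using homeomorphism_ident by blast
qed (auto intro!: exI[of _ "\<lambda>t :: real. t"] simp: strict_mono_def)

lemma orientation_preserving_homeo_inj:
  assumes "orientation_preserving_homeo h"
  shows "inj_on h (sphere 0 1)"
proof -
  obtain k where "homeomorphism (sphere 0 1) (sphere 0 1) h k"
    using assms unfolding orientation_preserving_homeo_def by blast
  then show ?thesis
    by (intro inj_on_inverseI[of _ k]) (simp add: homeomorphism_def)
qed

lemma orientation_preserving_homeo_lift:
  assumes "orientation_preserving_homeo h"
  obtains F :: "real \<Rightarrow> real" where "strict_mono F" "\<And>t. h (cis t) = cis (F t)"
    "\<And>t (j :: int). F (t + 2 * pi * j) = F t + 2 * pi * j"
proof -
  obtain F :: "real \<Rightarrow> real" where F: "strict_mono F" "\<And>t. h (cis t) = cis (F t)"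
    "\<And>t. F (t + 2 * pi) = F t + 2 * pi"
    using assms unfolding orientation_preserving_homeo_def by blast
  have nonneg: "F (t + 2 * pi * real n) = F t + 2 * pi * real n" for t and n :: nat
  proof (induction n)
    case (Suc n)
    then show ?case
      using F(3)[of "t + 2 * pi * real n"] by (simp add: algebra_simps)
  qed simp
  have "F (t + 2 * pi * j) = F t + 2 * pi * j" for t and j :: int
  proof (cases "j \<ge> 0")
    case True
    then show ?thesis
      using nonneg[of t "nat j"] by simp
  next
    case False
    then show ?thesis
      using nonneg[of "t + 2 * pi * j" "nat (- j)"] by simp
  qed
  then show ?thesis
    using that F by blast
qed

text \<open>The change of enumeration is an increasing bijection of the integers, hence a
  translation.\<close>

lemma strict_mono_same_range_shift:
  fixes A B :: "int \<Rightarrow> 'a::linorder"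
  assumes "strict_mono A" "strict_mono B" "range A = range B"
  obtains d where "\<And>k. A k = B (k + d)"
proof -
  define e where "e k = (SOME j. A k = B j)" for k
  have e: "A k = B (e k)" for k
    unfolding e_def using assms(3) by (metis (mono_tags, lifting) rangeE rangeI someI_ex)
  have mono: "e j < e k \<longleftrightarrow> j < k" for j k
    using e strict_mono_less[OF assms(1)] strict_mono_less[OF assms(2)] by metis
  have surj: "\<exists>k. e k = j" for j
    using e strict_mono_eq[OF assms(2)] assms(3) by (metis rangeE rangeI)
  have step: "e (k + 1) = e k + 1" for k
  proof -
    obtain j where j: "e j = e k + 1"
      using surj by blast
    then have "k < j"
      using mono[of k j] by simp
    then have "e (k + 1) \<le> e j"
      using mono[of j "k + 1"] by linarith
    moreover have "e k < e (k + 1)"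
      using mono by simp
    ultimately show ?thesis
      using j by simp
  qed
  have "e k = k + e 0" for k
  proof (induction k rule: int_induct[where k = 0])
    case (step1 i)
    then show ?case
      using step[of i] by simp
  next
    case (step2 i)
    then show ?case
      using step[of "i - 1"] by simp
  qed simp
  with e that show ?thesis
    by metis
qed

definition grid_chords :: "nat \<Rightarrow> (int \<Rightarrow> int \<Rightarrow> bool) \<Rightarrow> complex set set" where
  "grid_chords M R = {{grid_point M p, grid_point M q} | p q. R p q}"

lemma Union_grid_chords:
  assumes "\<And>p. \<exists>q. R p q"
  shows "\<Union> (grid_chords M R) = range (grid_point M)"
proof (intro equalityI subsetI)
  fix u assume "u \<in> range (grid_point M)"
  then obtain p where "u = grid_point M p"
    by blast
  moreover obtain q where "R p q"
    using assms by blast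
  ultimately show "u \<in> \<Union> (grid_chords M R)"
    unfolding grid_chords_def by (intro UnionI[of "{u, grid_point M q}"]) auto
qed (auto simp: grid_chords_def)

text \<open>Angles over the image of the grid are lifted grid angles up to whole turns, and a whole
  turn is absorbed by shifting the index by \<open>M\<close>.\<close>

lemma lift_range:
  assumes "0 < M" and lift: "\<And>t. h (cis t) = cis (F t)"
    and period: "\<And>t (j :: int). F (t + 2 * pi * j) = F t + 2 * pi * j"
  shows "range (\<lambda>k :: int. F (2 * pi * real_of_int k / real M)) = {t. cis t \<in> h ` range (grid_point M)}"
proof (intro set_eqI iffI)
  fix t assume "t \<in> range (\<lambda>k :: int. F (2 * pi * real_of_int k / real M))"
  then obtain k :: int where "t = F (2 * pi * real_of_int k / real M)"
    by blast
  then have "cis t = h (grid_point M k)"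
    by (simp add: grid_point_def lift)
  then show "t \<in> {t. cis t \<in> h ` range (grid_point M)}"
    by blast
next
  fix t assume "t \<in> {t. cis t \<in> h ` range (grid_point M)}"
  then obtain k where "cis t = cis (F (2 * pi * real_of_int k / real M))"
    by (auto simp: grid_point_def lift)
  then obtain j :: int where "t = F (2 * pi * real_of_int k / real M) + 2 * pi * j"
    unfolding cis_eq_iff by blast
  also have "\<dots> = F (2 * pi * real_of_int (k + int M * j) / real M)"
    using assms(1) unfolding period[symmetric] by (simp add: field_simps)
  finally show "t \<in> range (\<lambda>k :: int. F (2 * pi * real_of_int k / real M))"
    by blast
qed

text \<open>One direction of the rotation statement, to be used with \<open>d\<close> and with
  \<open>- d\<close>. Injectivity of \<open>h'\<close> pulls the equality of image chords back; as
  chords are unordered, symmetry of \<open>R'\<close> settles the crossed matching.\<close>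

lemma grid_chords_transfer:
  assumes "0 < M" and inj: "inj_on h' (sphere 0 1)"
    and d: "\<And>k. h (grid_point M k) = h' (grid_point M (k + d))"
    and C: "(`) h ` grid_chords M R = (`) h' ` grid_chords M R'"
    and sym: "\<And>p q. R' p q \<Longrightarrow> R' q p"
    and cong: "\<And>p q p' q'. p mod int M = p' mod int M \<Longrightarrow> q mod int M = q' mod int M \<Longrightarrow> R' p q = R' p' q'"
    and "R p q"
  shows "R' (p + d) (q + d)"
proof -
  have "{grid_point M p, grid_point M q} \<in> grid_chords M R"
    using \<open>R p q\<close> by (auto simp: grid_chords_def)
  then obtain c where c: "c \<in> grid_chords M R'" "h ` {grid_point M p, grid_point M q} = h' ` c"
    using C by blast
  then obtain p' q' where pq': "R' p' q'" "c = {grid_point M p', grid_point M q'}"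
    by (auto simp: grid_chords_def)
  have S: "grid_point M k \<in> sphere 0 1" for k
    by (simp add: grid_point_def)
  have "h' ` {grid_point M (p + d), grid_point M (q + d)} = h' ` {grid_point M p', grid_point M q'}"
    using c(2) d pq'(2) by simp
  then have "{grid_point M (p + d), grid_point M (q + d)} = {grid_point M p', grid_point M q'}"
    using inj_on_image_eq_iff[OF inj, of "{grid_point M (p + d), grid_point M (q + d)}"
        "{grid_point M p', grid_point M q'}"] S by blast
  then have "(p + d) mod int M = p' mod int M \<and> (q + d) mod int M = q' mod int M \<or>
      (p + d) mod int M = q' mod int M \<and> (q + d) mod int M = p' mod int M"
    using grid_point_eq_iff[OF assms(1)] by (auto simp: doubleton_eq_iff)
  then show ?thesis
    using pq'(1) sym cong by blast
qed

text \<open>On the endpoints of the chords, an orientation-preserving homeomorphism can only act as a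
  rotation: the two lifts enumerate the same discrete subset of the line in increasing order.\<close>

lemma homeo_grid_chords_rotation:
  assumes "0 < M" and h: "orientation_preserving_homeo h" "orientation_preserving_homeo h'"
    and C: "(`) h ` grid_chords M R = (`) h' ` grid_chords M R'"
    and total: "\<And>p. \<exists>q. R p q" "\<And>p. \<exists>q. R' p q"
    and sym: "\<And>p q. R p q \<Longrightarrow> R q p" "\<And>p q. R' p q \<Longrightarrow> R' q p"
    and cong: "\<And>p q p' q'. p mod int M = p' mod int M \<Longrightarrow> q mod int M = q' mod int M \<Longrightarrow> R p q = R p' q'"
      "\<And>p q p' q'. p mod int M = p' mod int M \<Longrightarrow> q mod int M = q' mod int M \<Longrightarrow> R' p q = R' p' q'"
  obtains d where "\<And>p q. R p q \<longleftrightarrow> R' (p + d) (q + d)"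
proof -
  obtain F :: "real \<Rightarrow> real" where F: "strict_mono F" "\<And>t. h (cis t) = cis (F t)"
    "\<And>t (j :: int). F (t + 2 * pi * j) = F t + 2 * pi * j"
    using orientation_preserving_homeo_lift[OF h(1)] by blast
  obtain F' :: "real \<Rightarrow> real" where F': "strict_mono F'" "\<And>t. h' (cis t) = cis (F' t)"
    "\<And>t (j :: int). F' (t + 2 * pi * j) = F' t + 2 * pi * j"
    using orientation_preserving_homeo_lift[OF h(2)] by blast
  let ?A = "\<lambda>k :: int. F (2 * pi * real_of_int k / real M)"
  let ?B = "\<lambda>k :: int. F' (2 * pi * real_of_int k / real M)"
  have "h ` range (grid_point M) = h' ` range (grid_point M)"
    using arg_cong[OF C, of Union] Union_grid_chords[of R M, OF total(1)]
      Union_grid_chords[of R' M, OF total(2)] by (simp add: image_Union[symmetric])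
  then have "range ?A = range ?B"
    using lift_range[OF assms(1) F(2,3)] lift_range[OF assms(1) F'(2,3)] by simp
  moreover have "strict_mono ?A" "strict_mono ?B"
    using F(1) F'(1) assms(1) by (auto simp: strict_mono_def divide_strict_right_mono)
  ultimately obtain d where d: "\<And>k. ?A k = ?B (k + d)"
    using strict_mono_same_range_shift[of ?A ?B] by blast
  have hd: "h (grid_point M k) = h' (grid_point M (k + d))" for k
    unfolding grid_point_def F(2) F'(2) d ..
  have hd': "h' (grid_point M k) = h (grid_point M (k + (- d)))" for k
    using hd[of "k - d"] by simp
  have "R' (p + d) (q + d)" if "R p q" for p q
    by (rule grid_chords_transfer[where R = R and R' = R', OF assms(1) orientation_preserving_homeo_inj[OF h(2)] hd C])
      (fact sym(2) cong(2) that)+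
  moreover have "R p q" if "R' (p + d) (q + d)" for p q
  proof -
    have "R (p + d + - d) (q + d + - d)"
      by (rule grid_chords_transfer[where R = R' and R' = R, OF assms(1) orientation_preserving_homeo_inj[OF h(1)] hd' C[symmetric]])
        (fact sym(1) cong(1) that)+
    then show ?thesis
      by simp
  qed
  ultimately show ?thesis
    using that[of d] by blast
qed

section \<open>The run of a word on three strands\<close>

lemma periodic_induct:
  fixes N :: nat
  assumes "0 < N" and base: "\<And>i. i < N \<Longrightarrow> P i" and step: "\<And>i. P i \<Longrightarrow> P (i + N)"
  shows "P i"
proof (induction i rule: less_induct)
  case (less i)
  show ?case
  proof (cases "i < N")
    case False
    then have "P (i - N + N)"
      using less[of "i - N"] assms(1) by (intro step) auto
    then show ?thesis
      using False by simp
  qed (rule base)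
qed

locale closed_word =
  fixes V :: "letter list"
  assumes word_on: "word_on 3 V" and nonempty: "V \<noteq> []"
begin

abbreviation "N \<equiv> length V"

abbreviation "L \<equiv> closure_labels 3 V"

definition on_strand :: "nat \<Rightarrow> nat \<Rightarrow> bool" where
  "on_strand k i \<longleftrightarrow> k \<in> {fst (V ! i), snd (V ! i)}"

definition count :: "nat \<Rightarrow> nat \<Rightarrow> nat" where
  "count k i = length (filter (on_strand k) [0..<i])"

text \<open>Index in the closure of the next end on strand \<open>k\<close> once \<open>i\<close>
  letters have been passed; the offset counts the ends on earlier strands, so a strand ends where
  the next one begins.\<close>

definition pos :: "nat \<Rightarrow> nat \<Rightarrow> nat" where
  "pos k i = (if k = 1 then 0 else if k = 2 then count 1 N else count 1 N + count 2 N) + count k i"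

lemma N_pos: "0 < N"
  using nonempty by simp

lemma letters: "i < N \<Longrightarrow> V ! i \<in> {letter_a, letter_b, letter_c}"
proof -
  assume "i < N"
  then have "V ! i \<in> set V"
    by simp
  then have "1 \<le> fst (V ! i) \<and> fst (V ! i) < snd (V ! i) \<and> snd (V ! i) \<le> 3"
    using bspec[OF conjunct2[OF word_on[unfolded word_on_def]], of "V ! i"]
    by (simp add: case_prod_beta)
  then have "(fst (V ! i) = 1 \<and> (snd (V ! i) = 2 \<or> snd (V ! i) = 3)) \<or> (fst (V ! i) = 2 \<and> snd (V ! i) = 3)"
    by linarith
  then show ?thesis
    by (auto simp: prod_eq_iff)
qed

lemma strand_labels_eq: "strand_labels V k = filter (on_strand k) [0..<N]"
  unfolding strand_labels_def by (rule filter_cong) (simp_all add: on_strand_def)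

lemma count_Suc: "count k (Suc i) = count k i + (if on_strand k i then 1 else 0)"
  by (simp add: count_def)

lemma count_0 [simp]: "count k 0 = 0"
  by (simp add: count_def)

lemma count_mono: "i \<le> j \<Longrightarrow> count k i \<le> count k j"
  by (rule lift_Suc_mono_le[of "count k"]) (simp_all add: count_Suc)

lemma count_sum: "i \<le> N \<Longrightarrow> count 1 i + count 2 i + count 3 i = 2 * i"
proof (induction i)
  case (Suc i)
  then show ?case
    using letters[of i] by (auto simp: count_Suc on_strand_def)
qed simp

lemma L_eq: "L = strand_labels V 1 @ strand_labels V 2 @ strand_labels V 3"
proof -
  have "[1..<Suc 3] = [1, 2, 3]"
    by (simp add: numeral_3_eq_3 numeral_2_eq_2 One_nat_def)
  then show ?thesis
    by (simp add: closure_labels_def)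
qed

lemma length_strand_labels: "length (strand_labels V k) = count k N"
  by (simp add: strand_labels_eq count_def)

lemma length_L: "length L = 2 * N"
  using count_sum[of N] by (simp add: L_eq length_strand_labels)

lemma strand_labels_nth:
  assumes "i < N" "on_strand k i"
  shows "count k i < count k N" "strand_labels V k ! count k i = i"
  using filter_upt_nth[of "on_strand k" i N] assms by (simp_all add: strand_labels_eq count_def)

lemma L_pos:
  assumes "i < N" "on_strand k i" "k \<in> {1, 2, 3}"
  shows "pos k i < 2 * N" "L ! pos k i = i"
proof -
  consider "k = 1" | "k = 2" | "k = 3"
    using assms(3) by blast
  then have "pos k i < 2 * N \<and> L ! pos k i = i"
    using strand_labels_nth[OF assms(1,2)] count_sum[of N]
    by cases (simp_all add: L_eq pos_def nth_append length_strand_labels)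
  then show "pos k i < 2 * N" "L ! pos k i = i"
    by auto
qed

lemma pos_cases:
  assumes "p < 2 * N"
  obtains k i where "k \<in> {1, 2, 3}" "i < N" "on_strand k i" "p = pos k i"
proof -
  have idx: "\<exists>i<N. on_strand k i \<and> q = count k i" if "q < count k N" for k q
    using filter_upt_index[of q "on_strand k" N] that unfolding count_def by metis
  consider "p < count 1 N" | "count 1 N \<le> p" "p - count 1 N < count 2 N"
    | "count 1 N + count 2 N \<le> p" "p - (count 1 N + count 2 N) < count 3 N"
    using assms count_sum[of N] by linarith
  then show ?thesis
  proof cases
    case 1
    then obtain i where "i < N" "on_strand 1 i" "p = count 1 i"
      using idx by blast
    then show ?thesis
      using that[of 1 i] by (simp add: pos_def)
  next
    case 2
    then obtain i where "i < N" "on_strand 2 i" "p - count 1 N = count 2 i"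
      using idx by blast
    then show ?thesis
      using that[of 2 i] 2 by (simp add: pos_def)
  next
    case 3
    then obtain i where "i < N" "on_strand 3 i" "p - (count 1 N + count 2 N) = count 3 i"
      using idx by blast
    then show ?thesis
      using that[of 3 i] 3 by (simp add: pos_def)
  qed
qed

lemma pos_less:
  assumes "i < N" "j < N" "on_strand k i" "on_strand k' j" "k < k'" "k \<in> {1, 2, 3}" "k' \<in> {1, 2, 3}"
  shows "pos k i < pos k' j"
proof -
  consider "k = 1" "k' = 2" | "k = 1" "k' = 3" | "k = 2" "k' = 3"
    using assms(5-7) by auto
  then show ?thesis
    using strand_labels_nth(1)[OF assms(1,3)] by cases (simp_all add: pos_def)
qed

text \<open>An index is determined by its strand and its label, and no letter meets all three
  strands.\<close>

lemma exactly_two: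
  assumes "p < 2 * N" "q < 2 * N" "r < 2 * N" "L ! p = L ! q" "L ! p = L ! r" "p \<noteq> q" "p \<noteq> r"
  shows "q = r"
proof -
  have at: "\<exists>k\<in>{1, 2, 3}. L ! u < N \<and> on_strand k (L ! u) \<and> u = pos k (L ! u)" if "u < 2 * N" for u
    using pos_cases[OF that] L_pos(2) by metis
  have "\<not> (on_strand 1 i \<and> on_strand 2 i \<and> on_strand 3 i)" if "i < N" for i
    using letters[OF that] by (auto simp: on_strand_def)
  then show ?thesis
    using at[OF assms(1)] at[OF assms(2)] at[OF assms(3)] assms(4-7) by auto
qed

section \<open>The chord relation of the closure\<close>

abbreviation "R \<equiv> label_chord L"

lemma R_pos:
  assumes "i < N" "on_strand k i" "on_strand k' i" "k < k'" "k \<in> {1, 2, 3}" "k' \<in> {1, 2, 3}"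
  shows "R (int (pos k i)) (int (pos k' i))"
  using pos_less[OF assms(1,1,2,3,4,5,6)]
  by (simp add: label_chord_nat length_L L_pos[OF assms(1,2,5)] L_pos[OF assms(1,3,6)])

lemma R_symmetric: "R p q \<Longrightarrow> R q p"
  unfolding label_chord_def by metis

lemma R_cong_mod:
  "p mod int (2 * N) = p' mod int (2 * N) \<Longrightarrow> q mod int (2 * N) = q' mod int (2 * N) \<Longrightarrow> R p q = R p' q'"
  by (simp add: label_chord_def length_L)

lemma R_total: "\<exists>q. R p q"
proof -
  define p' where "p' = nat (p mod int (2 * N))"
  have p': "int p' = p mod int (2 * N)" "p' < 2 * N"
    using N_pos by (auto simp: p'_def nat_less_iff)
  obtain k i where k: "k \<in> {1, 2, 3}" "i < N" "on_strand k i" "p' = pos k i"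
    using pos_cases[OF p'(2)] by blast
  have "\<exists>k'\<in>{1, 2, 3}. on_strand k' i \<and> k' \<noteq> k"
    using letters[OF k(2)] k(1) by (auto simp: on_strand_def)
  then obtain k' where k': "k' \<in> {1, 2, 3}" "on_strand k' i" "k' \<noteq> k"
    by blast
  have "R (int p') (int (pos k' i))"
    using R_pos[OF k(2,3) k'(2)] R_symmetric[OF R_pos[OF k(2) k'(2) k(3)]] k(1,4) k'(1,3)
    by (cases k k' rule: linorder_cases) simp_all
  then have "R p (int (pos k' i))"
    using R_cong_mod[of "int p'" p] p'(1) by simp
  then show ?thesis ..
qed

sublocale chord_line N R
proof
  fix p q q' :: int
  show "0 < N" by (rule N_pos)
  show "R p q \<Longrightarrow> R q p" by (rule R_symmetric)
  show "\<not> R p p" by (simp add: label_chord_def)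
  show "R (p + 2 * int N) q \<longleftrightarrow> R p q" by (rule R_cong_mod) auto
  assume "R p q" "R p q'"
  have lt: "nat (u mod int (2 * N)) < 2 * N" for u
    using N_pos by (simp add: nat_less_iff)
  have neq: "nat (u mod int (2 * N)) \<noteq> nat (v mod int (2 * N))"
    if "u mod int (2 * N) \<noteq> v mod int (2 * N)" for u v
    using that N_pos by (simp add: eq_nat_nat_iff)
  have "nat (q mod int (2 * N)) = nat (q' mod int (2 * N))"
    using \<open>R p q\<close> \<open>R p q'\<close> unfolding label_chord_def length_L
    by (intro exactly_two[OF lt[of p] lt lt] neq) simp_all
  then have "q mod int (2 * N) = q' mod int (2 * N)"
    using N_pos by (simp add: nat_eq_iff)
  then show "2 * int N dvd q - q'"
    by (simp add: mod_eq_dvd_iff)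
qed

text \<open>The continuation of the word by all of its cyclic permutations: in the \<open>e\<close>-th copy of the word,
  strand \<open>k\<close> continues along strand \<open>k + e\<close>, and every third copy completes a turn of the circle.\<close>

definition sheet :: "nat \<Rightarrow> nat \<Rightarrow> int" where
  "sheet k i = (let e = k + i div N in int (pos (Suc (e mod 3)) (i mod N)) + 2 * int N * int (e div 3))"

definition unwound :: "nat \<Rightarrow> letter" where
  "unwound i = (prev_letter ^^ (i div N)) (V ! (i mod N))"

lemma div_add_N: "(i + N) div N = Suc (i div N)"
  using N_pos by simp

lemma sheet_period: "sheet k (i + N) = sheet (Suc k) i" "sheet (k + 3) i = sheet k i + 2 * int N"
proof -
  show "sheet k (i + N) = sheet (Suc k) i"
    by (simp add: sheet_def div_add_N)
  have e: "k + 3 + i div N = (k + i div N) + 3"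
    by simp
  have "(e + 3) mod 3 = e mod 3" "(e + 3) div 3 = e div 3 + 1" for e :: nat
    by presburger+
  then show "sheet (k + 3) i = sheet k i + 2 * int N"
    unfolding sheet_def Let_def e by (simp only: of_nat_add of_nat_1 distrib_left mult_1_right)
qed

lemma unwound_period: "unwound (i + N) = prev_letter (unwound i)"
  unfolding unwound_def div_add_N by simp

lemma sheet_pos:
  assumes "i \<le> N" "k < 3"
  shows "sheet k i = int (pos (Suc k) i)"
proof (cases "i = N")
  \<comment> \<open>Here \<open>sheet\<close> already refers to the start of the next strand, which
    is the end of this one; strand 3 ends one full turn after the start of strand 1.\<close>
  case True
  have "N div N = 1" "N mod N = 0"
    using N_pos by simp_all
  then have s: "sheet k N = int (pos (Suc ((k + 1) mod 3)) 0) + 2 * int N * int ((k + 1) div 3)"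
    by (simp only: sheet_def Let_def)
  have "k = 0 \<or> k = 1 \<or> k = 2"
    using assms(2) by linarith
  then have "sheet k N = int (pos (Suc k) N)"
    unfolding s using count_sum[of N] by (elim disjE) (simp_all add: pos_def One_nat_def numeral_2_eq_2[symmetric])
  with True show ?thesis
    by simp
next
  case False
  then have "i div N = 0" "i mod N = i"
    using assms by simp_all
  then show ?thesis
    using assms(2) by (simp add: sheet_def)
qed

text \<open>All conditions are carried along by the shift by \<open>N\<close>, so they are checked
  on the first copy of the word, where the sheets count ends on the strands. Strictness of the order
  comes from \<open>run_if_no_ties\<close>.\<close>

lemma unwound_run:
  assumes "\<not> parallel"
  shows "run unwound (sheet 0) (sheet 1) (sheet 2)"
proof (rule run_if_no_ties[OF _ _ _ _ _ _ _ _ assms])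
  show per: "unwound (i + N) = prev_letter (unwound i)" "sheet 0 (i + N) = sheet 1 i"
    "sheet 1 (i + N) = sheet 2 i" "sheet 2 (i + N) = sheet 0 i + 2 * int N" for i
  proof -
    show "unwound (i + N) = prev_letter (unwound i)"
      by (rule unwound_period)
    show "sheet 0 (i + N) = sheet 1 i"
      using sheet_period(1)[of 0 i] by (simp only: One_nat_def)
    show "sheet 1 (i + N) = sheet 2 i"
      using sheet_period(1)[of 1 i] by (simp only: One_nat_def numeral_2_eq_2)
    show "sheet 2 (i + N) = sheet 0 i + 2 * int N"
      using sheet_period(1)[of 2 i] sheet_period(2)[of 0 i]
      by (simp only: numeral_3_eq_3 numeral_2_eq_2 add_0)
  qed
  have sheet: "sheet 0 i = int (count 1 i)" "sheet 1 i = int (count 1 N + count 2 i)"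
    "sheet 2 i = int (count 1 N + count 2 N + count 3 i)" if "i \<le> N" for i
    using that by (simp_all add: sheet_pos pos_def One_nat_def numeral_2_eq_2[symmetric])
  have le: "sheet 0 i \<le> sheet 1 i \<and> sheet 1 i \<le> sheet 2 i \<and> sheet 2 i \<le> sheet 0 i + 2 * int N" for i
  proof (induction i rule: periodic_induct[OF N_pos])
    case (1 i)
    then show ?case
      using count_mono[of i N 1] count_mono[of i N 2] count_mono[of i N 3] count_sum[of N]
        sheet[of i] by simp
  next
    case (2 i)
    then show ?case
      unfolding per by simp
  qed
  then show "sheet 0 i \<le> sheet 1 i" "sheet 1 i \<le> sheet 2 i" "sheet 2 i \<le> sheet 0 i + 2 * int N" for i
    by blast+
  show "(unwound i = letter_a \<and> R (sheet 0 i) (sheet 1 i) \<and> sheet 0 (Suc i) = sheet 0 i + 1 \<and>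
          sheet 1 (Suc i) = sheet 1 i + 1 \<and> sheet 2 (Suc i) = sheet 2 i) \<or>
        (unwound i = letter_b \<and> R (sheet 1 i) (sheet 2 i) \<and> sheet 0 (Suc i) = sheet 0 i \<and>
          sheet 1 (Suc i) = sheet 1 i + 1 \<and> sheet 2 (Suc i) = sheet 2 i + 1) \<or>
        (unwound i = letter_c \<and> R (sheet 0 i) (sheet 2 i) \<and> sheet 0 (Suc i) = sheet 0 i + 1 \<and>
          sheet 1 (Suc i) = sheet 1 i \<and> sheet 2 (Suc i) = sheet 2 i + 1)" for i
  proof (induction i rule: periodic_induct[OF N_pos])
    case (1 i)
    then have s: "sheet 0 i = int (pos 1 i)" "sheet 1 i = int (pos 2 i)" "sheet 2 i = int (pos 3 i)"
      using sheet[of i] by (simp_all add: pos_def)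
    have st: "sheet 0 (Suc i) = sheet 0 i + (if on_strand 1 i then 1 else 0)"
      "sheet 1 (Suc i) = sheet 1 i + (if on_strand 2 i then 1 else 0)"
      "sheet 2 (Suc i) = sheet 2 i + (if on_strand 3 i then 1 else 0)"
      using 1 sheet[of i] sheet[of "Suc i"] by (simp_all add: count_Suc)
    have u: "unwound i = V ! i"
      using 1 by (simp add: unwound_def)
    consider "V ! i = letter_a" | "V ! i = letter_b" | "V ! i = letter_c"
      using letters[OF 1] by blast
    then show ?case
    proof cases
      case 1
      then show ?thesis
        using R_pos[of i 1 2] \<open>i < N\<close> by (simp add: u st s on_strand_def)
    next
      case 2
      then show ?thesis
        using R_pos[of i 2 3] \<open>i < N\<close> by (simp add: u st s on_strand_def)
    next
      case 3
      then show ?thesis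
        using R_pos[of i 1 3] \<open>i < N\<close> by (simp add: u st s on_strand_def)
    qed
  next
    case (2 i)
    have S: "Suc (i + N) = Suc i + N"
      by simp
    show ?case
      unfolding S per using 2 R_sym R_period' by (elim disjE) auto
  qed
qed

lemma word_at_unwound: "word_at N unwound 0 = V"
  unfolding word_at_def by (rule nth_equalityI) (simp_all add: unwound_def)

lemma closure_chords_word: "closure_chords 3 V = grid_chords (2 * N) R"
  unfolding grid_chords_def using closure_chords_eq[OF length_L] N_pos by simp

end

section \<open>Diagrams with all chords parallel\<close>

text \<open>The \<open>N\<close> given chords reach every point from one end or the other, so each
  point is joined to its antipode, and partners are unique.\<close>

lemma (in chord_line) R_if_parallel:
  assumes parallel
  shows "R p q \<longleftrightarrow> 2 * int N dvd q - p - int N"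
proof -
  obtain p0 where p0: "\<And>t. t < N \<Longrightarrow> R (p0 + int t) (p0 + int N + int t)"
    using assms unfolding parallel_def by blast
  define s where "s = (p - p0) mod (2 * int N)"
  have s: "0 \<le> s" "s < 2 * int N" "2 * int N dvd p - p0 - s"
    using N_pos by (auto simp: s_def minus_mod_eq_mult_div)
  have opp: "R p (p + int N)"
  proof (cases "s < int N")
    case True
    then have "R (p0 + s) (p0 + int N + s)"
      using p0[of "nat s"] s by simp
    moreover have "2 * int N dvd p0 + s - p" "2 * int N dvd p0 + int N + s - (p + int N)"
      using s(3) by (simp_all add: dvd_diff_commute algebra_simps)
    ultimately show ?thesis
      using R_cong R_cong' by blast
  next
    case False
    then have "R (p0 + s) (p0 + s - int N)"
      using p0[of "nat (s - int N)"] s R_sym by (simp add: algebra_simps)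
    moreover have "2 * int N dvd p0 + s - p"
      using s(3) by (simp add: dvd_diff_commute algebra_simps)
    moreover have "2 * int N dvd p0 + s - int N - (p + int N)"
    proof -
      have "p0 + s - int N - (p + int N) = - (p - p0 - s) - 2 * int N"
        by simp
      then show ?thesis
        using s(3) by (metis dvd_diff dvd_minus_iff dvd_refl)
    qed
    ultimately show ?thesis
      using R_cong R_cong' by blast
  qed
  show ?thesis
  proof
    assume "R p q"
    then show "2 * int N dvd q - p - int N"
      using R_unique[OF _ opp, of q] by (simp add: algebra_simps)
  next
    assume "2 * int N dvd q - p - int N"
    then show "R p q"
      using opp R_cong'[of q "p + int N" p] by (simp add: algebra_simps)
  qed
qed

lemma closure_labels_replicate:
  "closure_labels 2 (replicate n letter_a) = [0..<n] @ [0..<n]"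
proof -
  have "[1..<Suc 2] = [1, 2]"
    by (simp add: numeral_3_eq_3 numeral_2_eq_2 One_nat_def)
  moreover have "strand_labels (replicate n letter_a) k = [0..<n]" if "k \<in> {1, 2}" for k
    using that by (auto simp: strand_labels_def filter_id_conv)
  ultimately show ?thesis
    by (simp add: closure_labels_def)
qed

lemma label_chord_upt_upt:
  assumes "0 < n"
  shows "label_chord ([0..<n] @ [0..<n]) p q \<longleftrightarrow> 2 * int n dvd q - p - int n"
proof -
  define p' q' where "p' = p mod (2 * int n)" and "q' = q mod (2 * int n)"
  have b: "0 \<le> p'" "p' < 2 * int n" "0 \<le> q'" "q' < 2 * int n"
    using assms by (auto simp: p'_def q'_def)
  have nth: "([0..<n] @ [0..<n]) ! nat u = (if u < int n then nat u else nat u - n)"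
    if "0 \<le> u" "u < 2 * int n" for u
    using that by (auto simp: nth_append nat_less_iff)
  have "label_chord ([0..<n] @ [0..<n]) p q \<longleftrightarrow>
      p' \<noteq> q' \<and> ([0..<n] @ [0..<n]) ! nat p' = ([0..<n] @ [0..<n]) ! nat q'"
    by (simp add: label_chord_def p'_def q'_def)
  also have "\<dots> \<longleftrightarrow> q' - p' - int n = 0 \<or> q' - p' - int n = - 2 * int n"
    unfolding nth[OF b(1,2)] nth[OF b(3,4)] using b by auto
  also have "\<dots> \<longleftrightarrow> 2 * int n dvd q' - p' - int n"
  proof
    assume "2 * int n dvd q' - p' - int n"
    then obtain c where c: "q' - p' - int n = 2 * int n * c"
      by blast
    then have "2 * int n * (- 2) < 2 * int n * c" "2 * int n * c < 2 * int n * 1"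
      using b by linarith+
    then have "- 2 < c" "c < 1"
      using assms mult_less_cancel_left_pos[of "2 * int n" "- 2" c]
        mult_less_cancel_left_pos[of "2 * int n" c 1] by simp_all
    then have "c = 0 \<or> c = - 1"
      by linarith
    then show "q' - p' - int n = 0 \<or> q' - p' - int n = - 2 * int n"
      using c by auto
  next
    assume "q' - p' - int n = 0 \<or> q' - p' - int n = - 2 * int n"
    then have "q' - p' - int n = 2 * int n * 0 \<or> q' - p' - int n = 2 * int n * (- 1)"
      by auto
    then show "2 * int n dvd q' - p' - int n"
      by (metis dvd_triv_left)
  qed
  also have "\<dots> \<longleftrightarrow> 2 * int n dvd q - p - int n"
  proof -
    have "q - p - int n = (q' - p' - int n) + 2 * int n * (q div (2 * int n) - p div (2 * int n))"
      by (simp add: p'_def q'_def minus_div_mult_eq_mod[symmetric] algebra_simps)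
    then show ?thesis
      by (metis dvd_add_left_iff dvd_triv_left)
  qed
  finally show ?thesis .
qed

text \<open>Both closures consist of the diameters of the same \<open>2 * N\<close> points, so they
  are equal as sets of chords. Braid index 3 excludes this.\<close>

lemma (in closed_word) parallel_closes_on_two_strands:
  assumes parallel "closes_to 3 V D"
  shows "closes_to 2 (replicate N letter_a) D"
proof -
  have "closure_chords 2 (replicate N letter_a) = closure_chords 3 V"
    using closure_chords_eq[of 2 "replicate N letter_a" "2 * N"] closure_chords_word N_pos
      R_if_parallel[OF assms(1)] label_chord_upt_upt[of N]
    by (simp add: closure_labels_replicate grid_chords_def)
  then show ?thesis
    using assms(2) by (auto simp: closes_to_def word_closure_def word_on_def)
qed

section \<open>The classification\<close>

text \<open>A rotation of the diagram is a translation of the unrolled circle, so it turns a run of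
  one word into a run along the chords of the other.\<close>

lemma (in chord_line) run_shift:
  assumes "chord_line N R'" and "\<And>p q. R p q \<longleftrightarrow> R' (p + d) (q + d)"
    and "chord_line.run N R' w x y z"
  shows "run w (\<lambda>i. x i - d) (\<lambda>i. y i - d) (\<lambda>i. z i - d)"
  using assms(3) unfolding run_def chord_line.run_def[OF assms(1)] assms(2)
  by (simp only: diff_add_cancel) auto

text \<open>A representative \<open>C\<close> of \<open>D\<close> lies in \<open>D\<close> by
  reflexivity, hence both closures are carried to \<open>C\<close>. With two separate
  homeomorphisms, none has to be inverted.\<close>

lemma closes_to_common_configuration:
  assumes D: "D \<in> chord_diagrams n" and V: "closes_to m V D" and W: "closes_to m W D"
  obtains h h' where "length V = n" "length W = n"
    "orientation_preserving_homeo h" "orientation_preserving_homeo h'"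
    "(`) h ` closure_chords m V = (`) h' ` closure_chords m W"
proof -
  obtain C where C: "C \<in> chord_configurations n" "D = same_diagram n `` {C}"
    using D unfolding chord_diagrams_def by (auto elim: quotientE)
  have "(C, C) \<in> same_diagram n"
    using C(1) orientation_preserving_homeo_id unfolding same_diagram_def by force
  then have "C \<in> D"
    using C(2) by blast
  then have VC: "(closure_chords m V, C) \<in> same_diagram (length V)"
    and WC: "(closure_chords m W, C) \<in> same_diagram (length W)"
    using V W unfolding closes_to_def word_closure_def by blast+
  have "length V = n" "length W = n"
    using VC WC C(1) by (auto simp: same_diagram_def chord_configurations_def)
  moreover obtain h h' where "orientation_preserving_homeo h" "(`) h ` closure_chords m V = C"
    "orientation_preserving_homeo h'" "(`) h' ` closure_chords m W = C"
    using VC WC unfolding same_diagram_def by auto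
  ultimately show ?thesis
    using that by simp
qed

theorem theorem4p1:
  fixes N :: nat and D :: "complex set set set" and V W :: "letter list"
  assumes "D \<in> chord_diagrams N"
    and "braid_index D = 3"
    and "closes_to 3 V D"
    and "closes_to 3 W D"
  shows "cyclically_equivalent V W \<or>
    (\<exists>l m n :: nat. 0 < l \<and> 0 < m \<and> 0 < n \<and>
       cyclically_equivalent V
         (replicate l letter_a @ replicate m letter_c @ replicate n letter_a) \<and>
       cyclically_equivalent W
         (replicate l letter_a @ replicate n letter_c @ replicate m letter_a))"
proof -
  obtain h h' where len: "length V = N" "length W = N"
    and h: "orientation_preserving_homeo h" "orientation_preserving_homeo h'"
      "(`) h ` closure_chords 3 V = (`) h' ` closure_chords 3 W"
    using closes_to_common_configuration[OF assms(1,3,4)] .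
  show ?thesis
  proof (cases "N = 0")
    case True
    then show ?thesis
      using len by simp
  next
    case False
    interpret V: closed_word V
      using assms(3) len False by (simp add: closed_word_def closes_to_def) auto
    interpret W: closed_word W
      using assms(4) len False by (simp add: closed_word_def closes_to_def) auto
    have not_two: "\<not> closes_to 2 U D" for U
    proof
      assume "closes_to 2 U D"
      then have "braid_index D \<le> 2"
        unfolding braid_index_def by (intro Least_le) blast
      then show False
        using assms(2) by simp
    qed
    have npV: "\<not> V.parallel"
      using V.parallel_closes_on_two_strands[OF _ assms(3)] not_two by blast
    have npW: "\<not> W.parallel"
      using W.parallel_closes_on_two_strands[OF _ assms(4)] not_two by blast
    obtain d where d: "\<And>p q. V.R p q \<longleftrightarrow> W.R (p + d) (q + d)"
    proof (rule homeo_grid_chords_rotation[of "2 * N" h h' V.R W.R])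
      show "(`) h ` grid_chords (2 * N) V.R = (`) h' ` grid_chords (2 * N) W.R"
        using h(3) V.closure_chords_word W.closure_chords_word len by simp
      show "V.R p q = V.R p' q'"
        if "p mod int (2 * N) = p' mod int (2 * N)" "q mod int (2 * N) = q' mod int (2 * N)" for p q p' q'
        using V.R_cong_mod that len(1) by metis
      show "W.R p q = W.R p' q'"
        if "p mod int (2 * N) = p' mod int (2 * N)" "q mod int (2 * N) = q' mod int (2 * N)" for p q p' q'
        using W.R_cong_mod that len(2) by metis
      show "0 < 2 * N"
        using False by simp
    qed (rule h V.R_total W.R_total | erule V.R_symmetric W.R_symmetric | blast)+
    have run_V: "V.run V.unwound (V.sheet 0) (V.sheet 1) (V.sheet 2)"
      using V.unwound_run[OF npV] .
    have run_W: "V.run W.unwound (\<lambda>i. W.sheet 0 i - d) (\<lambda>i. W.sheet 1 i - d) (\<lambda>i. W.sheet 2 i - d)"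
    proof (rule V.run_shift[OF _ d])
      show "chord_line (length V) W.R"
        unfolding len(1) unfolding len(2)[symmetric] by (rule W.chord_line_axioms)
      show "chord_line.run (length V) W.R W.unwound (W.sheet 0) (W.sheet 1) (W.sheet 2)"
        unfolding len(1) unfolding len(2)[symmetric] by (rule W.unwound_run[OF npW])
    qed
    have word_W: "word_at (length V) W.unwound 0 = W"
      unfolding len(1) unfolding len(2)[symmetric] by (rule W.word_at_unwound)
    have "cyclically_equivalent V W \<or> V.flype_related V W"
      using V.runs_equivalent[OF run_V run_W npV] unfolding V.word_at_unwound word_W .
    then show ?thesis
      unfolding V.flype_related_def .
  qed
qed

end
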